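(* Let $\mathcal E$ be an essentially small idempotent-complete exact category with enough projective objects. If $X\rightarrowtail Y$ is an inflation in $\mathcal E$, then $$\operatorname{ddell}_{\mathcal E}X\le\operatorname{ddell}_{\mathcal E}Y+1 .$$
   Context: Short exact sequences of the exact structure are called conflations; the first map of a conflation is an inflation. For each $X\in\mathcal E$ fix a conflation $0\to\Omega_{\mathcal E}X\to P_X\to X\to0$ with $P_X$ projective. The stable category $\underline{\mathcal E}=\mathcal E/[\operatorname{Proj}\mathcal E]$ has morphisms modulo those factoring through projectives, and $\Omega_{\mathcal E}$ is an endofunctor of it. $X$ is a stable retract of $Y$ if there are $u:X\to Y$, $v:Y\to X$ in $\underline{\mathcal E}$ with $vu=1_X$. For $k\ge1$, $$k\text{-}\operatorname{dell}_{\mathcal E}X=\inf\{n\ge0\mid \Omega_{\mathcal E}^nX\text{ is a stable retract of }\Omega_{\mathcal E}^{n+k}Y\text{ for some }Y\in\mathcal E\}.$$ A sequence $0\to C_t\to\cdots\to C_0\to X\to0$ is admissibly exact if there are objects $Z_0=X,Z_1,\dots,Z_t=C_t$ and conflations $0\to Z_{i+1}\to C_i\to Z_i\to0$ for $0\le i<t$ from which it is spliced (for $t=0$: $C_0\to X$ is an isomorphism). $k\text{-}\operatorname{ddell}_{\mathcal E}X$ is the infimum of the integers $m\ge0$ such that there are $0\le t\le m$ and an admissibly exact sequence $0\to C_t\to\cdots\to C_0\to X\to0$ with $(i+k)\text{-}\operatorname{dell}_{\mathcal E}C_i\le m-i$ for $0\le i\le t$. ($\inf\emptyset=\infty$.)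 $\operatorname{ddell}_{\mathcal E}$ means $1\text{-}\operatorname{ddell}_{\mathcal E}$. *)

theory Defs
  imports "HOL-Algebra.Coset" "HOL-Library.Extended_Nat"
begin

section \<open>Categories\<close>

record ('o, 'm) category =
  Obj :: "'o set"
  Arr :: "'m set"
  Dom :: "'m \<Rightarrow> 'o"
  Cod :: "'m \<Rightarrow> 'o"
  Id :: "'o \<Rightarrow> 'm"
  Comp :: "'m \<Rightarrow> 'm \<Rightarrow> 'm"  (infixl "\<cdot>\<index>" 70)

definition Hom :: "('o, 'm, 'x) category_scheme \<Rightarrow> 'o \<Rightarrow> 'o \<Rightarrow> 'm set" where
  "Hom C X Y = {f \<in> Arr C. Dom C f = X \<and> Cod C f = Y}"

locale category =
  fixes C :: "('o, 'm, 'x) category_scheme" (structure)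
  assumes Dom_closed: "f \<in> Arr C \<Longrightarrow> Dom C f \<in> Obj C"
    and Cod_closed: "f \<in> Arr C \<Longrightarrow> Cod C f \<in> Obj C"
    and Id_closed: "X \<in> Obj C \<Longrightarrow> Id C X \<in> Hom C X X"
    and Comp_closed: "f \<in> Hom C X Y \<Longrightarrow> g \<in> Hom C Y Z \<Longrightarrow> g \<cdot> f \<in> Hom C X Z"
    and Comp_Id: "f \<in> Hom C X Y \<Longrightarrow> f \<cdot> Id C X = f"
    and Id_Comp: "f \<in> Hom C X Y \<Longrightarrow> Id C Y \<cdot> f = f"
    and Comp_assoc:
      "f \<in> Hom C W X \<Longrightarrow> g \<in> Hom C X Y \<Longrightarrow> h \<in> Hom C Y Z \<Longrightarrow> h \<cdot> (g \<cdot> f) = (h \<cdot> g) \<cdot> f"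

definition iso_arr :: "('o, 'm, 'x) category_scheme \<Rightarrow> 'm \<Rightarrow> bool" where
  "iso_arr C f \<longleftrightarrow> f \<in> Arr C \<and>
     (\<exists>g \<in> Hom C (Cod C f) (Dom C f).
        g \<cdot>\<^bsub>C\<^esub> f = Id C (Dom C f) \<and> f \<cdot>\<^bsub>C\<^esub> g = Id C (Cod C f))"

definition retract_of :: "('o, 'm, 'x) category_scheme \<Rightarrow> 'o \<Rightarrow> 'o \<Rightarrow> bool" where
  "retract_of C X Y \<longleftrightarrow> (\<exists>u \<in> Hom C X Y. \<exists>v \<in> Hom C Y X. v \<cdot>\<^bsub>C\<^esub> u = Id C X)"

definition idempotent_complete :: "('o, 'm, 'x) category_scheme \<Rightarrow> bool" where
  "idempotent_complete C \<longleftrightarrow>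
     (\<forall>X \<in> Obj C. \<forall>e \<in> Hom C X X. e \<cdot>\<^bsub>C\<^esub> e = e \<longrightarrow>
        (\<exists>Y \<in> Obj C. \<exists>r \<in> Hom C X Y. \<exists>s \<in> Hom C Y X. s \<cdot>\<^bsub>C\<^esub> r = e \<and> r \<cdot>\<^bsub>C\<^esub> s = Id C Y))"

definition zero_object :: "('o, 'm, 'x) category_scheme \<Rightarrow> 'o \<Rightarrow> bool" where
  "zero_object C Z \<longleftrightarrow> Z \<in> Obj C \<and>
     (\<forall>X \<in> Obj C. (\<exists>!f. f \<in> Hom C X Z) \<and> (\<exists>!f. f \<in> Hom C Z X))"

text \<open>In both squares below, \<open>i : A \<rightarrow> B\<close> and \<open>f : A \<rightarrow> A'\<close> are opposite to
  \<open>i' : A' \<rightarrow> B'\<close> and \<open>f' : B \<rightarrow> B'\<close>, respectively, and \<open>f' i = i' f\<close>.\<close>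

definition pushout_square :: "('o, 'm, 'x) category_scheme \<Rightarrow> 'm \<Rightarrow> 'm \<Rightarrow> 'm \<Rightarrow> 'm \<Rightarrow> bool" where
  "pushout_square C i f i' f' \<longleftrightarrow>
     (\<exists>A B A' B'. i \<in> Hom C A B \<and> f \<in> Hom C A A' \<and> i' \<in> Hom C A' B' \<and> f' \<in> Hom C B B' \<and>
        f' \<cdot>\<^bsub>C\<^esub> i = i' \<cdot>\<^bsub>C\<^esub> f \<and>
        (\<forall>T \<in> Obj C. \<forall>b \<in> Hom C B T. \<forall>a \<in> Hom C A' T. b \<cdot>\<^bsub>C\<^esub> i = a \<cdot>\<^bsub>C\<^esub> f \<longrightarrow>
           (\<exists>!h. h \<in> Hom C B' T \<and> h \<cdot>\<^bsub>C\<^esub> f' = b \<and> h \<cdot>\<^bsub>C\<^esub> i' = a)))"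

definition pullback_square :: "('o, 'm, 'x) category_scheme \<Rightarrow> 'm \<Rightarrow> 'm \<Rightarrow> 'm \<Rightarrow> 'm \<Rightarrow> bool" where
  "pullback_square C i f i' f' \<longleftrightarrow>
     (\<exists>A B A' B'. i \<in> Hom C A B \<and> f \<in> Hom C A A' \<and> i' \<in> Hom C A' B' \<and> f' \<in> Hom C B B' \<and>
        f' \<cdot>\<^bsub>C\<^esub> i = i' \<cdot>\<^bsub>C\<^esub> f \<and>
        (\<forall>T \<in> Obj C. \<forall>b \<in> Hom C T B. \<forall>a \<in> Hom C T A'. f' \<cdot>\<^bsub>C\<^esub> b = i' \<cdot>\<^bsub>C\<^esub> a \<longrightarrow>
           (\<exists>!h. h \<in> Hom C T A \<and> i \<cdot>\<^bsub>C\<^esub> h = b \<and> f \<cdot>\<^bsub>C\<^esub> h = a)))"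


section \<open>Additive categories\<close>

record ('o, 'm) preadditive = "('o, 'm) category" +
  Add :: "'m \<Rightarrow> 'm \<Rightarrow> 'm"
  Zero :: "'o \<Rightarrow> 'o \<Rightarrow> 'm"

definition hom_group :: "('o, 'm, 'x) preadditive_scheme \<Rightarrow> 'o \<Rightarrow> 'o \<Rightarrow> 'm monoid" where
  "hom_group A X Y = \<lparr>carrier = Hom A X Y, monoid.mult = Add A, one = Zero A X Y\<rparr>"

locale preadditive_category = category A
  for A :: "('o, 'm, 'x) preadditive_scheme" (structure) +
  assumes comm_group_Hom: "X \<in> Obj A \<Longrightarrow> Y \<in> Obj A \<Longrightarrow> comm_group (hom_group A X Y)"
    and Comp_Add: "f \<in> Hom A X Y \<Longrightarrow> f' \<in> Hom A X Y \<Longrightarrow> g \<in> Hom A Y Z \<Longrightarrow>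
      g \<cdot> Add A f f' = Add A (g \<cdot> f) (g \<cdot> f')"
    and Add_Comp: "f \<in> Hom A X Y \<Longrightarrow> g \<in> Hom A Y Z \<Longrightarrow> g' \<in> Hom A Y Z \<Longrightarrow>
      Add A g g' \<cdot> f = Add A (g \<cdot> f) (g' \<cdot> f)"

definition biproduct ::
    "('o, 'm, 'x) preadditive_scheme \<Rightarrow> 'o \<Rightarrow> 'o \<Rightarrow> 'o \<Rightarrow> 'm \<Rightarrow> 'm \<Rightarrow> 'm \<Rightarrow> 'm \<Rightarrow> bool" where
  "biproduct A X Y B i j p q \<longleftrightarrow> B \<in> Obj A \<and>
     i \<in> Hom A X B \<and> j \<in> Hom A Y B \<and> p \<in> Hom A B X \<and> q \<in> Hom A B Y \<and>
     p \<cdot>\<^bsub>A\<^esub> i = Id A X \<and> q \<cdot>\<^bsub>A\<^esub> j = Id A Y \<and>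
     q \<cdot>\<^bsub>A\<^esub> i = Zero A X Y \<and> p \<cdot>\<^bsub>A\<^esub> j = Zero A Y X \<and>
     Add A (i \<cdot>\<^bsub>A\<^esub> p) (j \<cdot>\<^bsub>A\<^esub> q) = Id A B"

locale additive_category = preadditive_category +
  assumes ex_zero_object: "\<exists>Z. zero_object A Z"
    and ex_biproduct: "X \<in> Obj A \<Longrightarrow> Y \<in> Obj A \<Longrightarrow> \<exists>B i j p q. biproduct A X Y B i j p q"

definition kernel_of :: "('o, 'm, 'x) preadditive_scheme \<Rightarrow> 'm \<Rightarrow> 'm \<Rightarrow> bool" where
  "kernel_of A p i \<longleftrightarrow> i \<in> Arr A \<and> p \<in> Arr A \<and> Cod A i = Dom A p \<and>
     p \<cdot>\<^bsub>A\<^esub> i = Zero A (Dom A i) (Cod A p) \<and>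
     (\<forall>T \<in> Obj A. \<forall>f \<in> Hom A T (Dom A p). p \<cdot>\<^bsub>A\<^esub> f = Zero A T (Cod A p) \<longrightarrow>
        (\<exists>!h. h \<in> Hom A T (Dom A i) \<and> i \<cdot>\<^bsub>A\<^esub> h = f))"

definition cokernel_of :: "('o, 'm, 'x) preadditive_scheme \<Rightarrow> 'm \<Rightarrow> 'm \<Rightarrow> bool" where
  "cokernel_of A i p \<longleftrightarrow> i \<in> Arr A \<and> p \<in> Arr A \<and> Cod A i = Dom A p \<and>
     p \<cdot>\<^bsub>A\<^esub> i = Zero A (Dom A i) (Cod A p) \<and>
     (\<forall>T \<in> Obj A. \<forall>f \<in> Hom A (Cod A i) T. f \<cdot>\<^bsub>A\<^esub> i = Zero A (Dom A i) T \<longrightarrow>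
        (\<exists>!h. h \<in> Hom A (Cod A p) T \<and> h \<cdot>\<^bsub>A\<^esub> p = f))"


section \<open>Exact categories\<close>

text \<open>A member \<open>(i, p)\<close> of \<open>Confl E\<close> is the conflation
  \<open>0 \<rightarrow> Dom i \<rightarrow> Cod i = Dom p \<rightarrow> Cod p \<rightarrow> 0\<close>.\<close>

record ('o, 'm) exact_cat = "('o, 'm) preadditive" +
  Confl :: "('m \<times> 'm) set"

definition inflation :: "('o, 'm, 'x) exact_cat_scheme \<Rightarrow> 'm \<Rightarrow> bool" where
  "inflation E i \<longleftrightarrow> (\<exists>p. (i, p) \<in> Confl E)"

definition deflation :: "('o, 'm, 'x) exact_cat_scheme \<Rightarrow> 'm \<Rightarrow> bool" where
  "deflation E p \<longleftrightarrow> (\<exists>i. (i, p) \<in> Confl E)"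

text \<open>Quillen's axioms, in the form given by Keller and Buehler.\<close>

locale exact_category = additive_category E
  for E :: "('o, 'm, 'x) exact_cat_scheme" (structure) +
  assumes Confl_kernel: "(i, p) \<in> Confl E \<Longrightarrow> kernel_of E p i"
    and Confl_cokernel: "(i, p) \<in> Confl E \<Longrightarrow> cokernel_of E i p"
    and Confl_iso:
      "(i, p) \<in> Confl E \<Longrightarrow> i' \<in> Hom E X' Y' \<Longrightarrow> p' \<in> Hom E Y' Z' \<Longrightarrow>
       a \<in> Hom E (Dom E i) X' \<Longrightarrow> b \<in> Hom E (Cod E i) Y' \<Longrightarrow> c \<in> Hom E (Cod E p) Z' \<Longrightarrow>
       iso_arr E a \<Longrightarrow> iso_arr E b \<Longrightarrow> iso_arr E c \<Longrightarrow>
       b \<cdot> i = i' \<cdot> a \<Longrightarrow> c \<cdot> p = p' \<cdot> b \<Longrightarrow> (i', p') \<in> Confl E"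
    and inflation_Id: "X \<in> Obj E \<Longrightarrow> inflation E (Id E X)"
    and deflation_Id: "X \<in> Obj E \<Longrightarrow> deflation E (Id E X)"
    and inflation_Comp:
      "f \<in> Hom E X Y \<Longrightarrow> g \<in> Hom E Y Z \<Longrightarrow> inflation E f \<Longrightarrow> inflation E g \<Longrightarrow>
       inflation E (g \<cdot> f)"
    and deflation_Comp:
      "f \<in> Hom E X Y \<Longrightarrow> g \<in> Hom E Y Z \<Longrightarrow> deflation E f \<Longrightarrow> deflation E g \<Longrightarrow>
       deflation E (g \<cdot> f)"
    and inflation_pushout:
      "i \<in> Hom E X Y \<Longrightarrow> inflation E i \<Longrightarrow> f \<in> Hom E X X' \<Longrightarrow>
       \<exists>i' f'. pushout_square E i f i' f' \<and> inflation E i'"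
    and deflation_pullback:
      "p \<in> Hom E Y Z \<Longrightarrow> deflation E p \<Longrightarrow> f \<in> Hom E Z' Z \<Longrightarrow>
       \<exists>p' f'. pullback_square E p' f' p f \<and> deflation E p'"

definition projective :: "('o, 'm, 'x) exact_cat_scheme \<Rightarrow> 'o \<Rightarrow> bool" where
  "projective E P \<longleftrightarrow> P \<in> Obj E \<and>
     (\<forall>p. deflation E p \<longrightarrow>
        (\<forall>f \<in> Hom E P (Cod E p). \<exists>g \<in> Hom E P (Dom E p). p \<cdot>\<^bsub>E\<^esub> g = f))"

definition enough_projectives :: "('o, 'm, 'x) exact_cat_scheme \<Rightarrow> bool" where
  "enough_projectives E \<longleftrightarrow>
     (\<forall>X \<in> Obj E. \<exists>P. projective E P \<and> (\<exists>p \<in> Hom E P X. deflation E p))"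


section \<open>The stable category\<close>

definition proj_factoring :: "('o, 'm, 'x) exact_cat_scheme \<Rightarrow> 'o \<Rightarrow> 'o \<Rightarrow> 'm set" where
  "proj_factoring E X Y =
     {b \<cdot>\<^bsub>E\<^esub> a | a b P. projective E P \<and> a \<in> Hom E X P \<and> b \<in> Hom E P Y}"

definition stable_class :: "('o, 'm, 'x) exact_cat_scheme \<Rightarrow> 'm \<Rightarrow> 'm set" where
  "stable_class E f =
     proj_factoring E (Dom E f) (Cod E f) #>\<^bsub>hom_group E (Dom E f) (Cod E f)\<^esub> f"

text \<open>A stable morphism is a nonempty coset in a single Hom-group, so that its domain and
  codomain are those of any representative.\<close>

definition stable_category :: "('o, 'm, 'x) exact_cat_scheme \<Rightarrow> ('o, 'm set) category" where
  "stable_category E =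
     \<lparr>Obj = Obj E,
      Arr = stable_class E ` Arr E,
      Dom = (\<lambda>F. Dom E (SOME f. f \<in> F)),
      Cod = (\<lambda>F. Cod E (SOME f. f \<in> F)),
      Id = (\<lambda>X. stable_class E (Id E X)),
      Comp = (\<lambda>G F. stable_class E ((SOME g. g \<in> G) \<cdot>\<^bsub>E\<^esub> (SOME f. f \<in> F)))\<rparr>"

abbreviation stable_retract :: "('o, 'm, 'x) exact_cat_scheme \<Rightarrow> 'o \<Rightarrow> 'o \<Rightarrow> bool" where
  "stable_retract E \<equiv> retract_of (stable_category E)"


section \<open>Syzygies and (derived) delooping levels\<close>

text \<open>A choice \<open>S\<close> assigns to each object \<open>X\<close> a conflation \<open>\<Omega> X \<rightarrow> P\<^sub>X \<rightarrow> X\<close>.\<close>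

definition syzygy_choice :: "('o, 'm, 'x) exact_cat_scheme \<Rightarrow> ('o \<Rightarrow> 'm \<times> 'm) \<Rightarrow> bool" where
  "syzygy_choice E S \<longleftrightarrow>
     (\<forall>X \<in> Obj E. S X \<in> Confl E \<and> Cod E (snd (S X)) = X \<and> projective E (Dom E (snd (S X))))"

definition syzygy :: "('o, 'm, 'x) exact_cat_scheme \<Rightarrow> ('o \<Rightarrow> 'm \<times> 'm) \<Rightarrow> 'o \<Rightarrow> 'o" where
  "syzygy E S X = Dom E (fst (S X))"

definition dell ::
    "('o, 'm, 'x) exact_cat_scheme \<Rightarrow> ('o \<Rightarrow> 'm \<times> 'm) \<Rightarrow> nat \<Rightarrow> 'o \<Rightarrow> enat" where
  "dell E S k X =
     Inf (enat ` {n. \<exists>Y \<in> Obj E. stable_retract E ((syzygy E S ^^ n) X) ((syzygy E S ^^ (n + k)) Y)})"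

text \<open>\<open>d 0 : C 0 \<rightarrow> X\<close> and \<open>d i : C i \<rightarrow> C (i - 1)\<close> for \<open>0 < i \<le> t\<close> are the maps of the
  sequence; \<open>C\<close> and \<open>d\<close> are irrelevant beyond index \<open>t\<close>.\<close>

definition admissibly_exact ::
    "('o, 'm, 'x) exact_cat_scheme \<Rightarrow> 'o \<Rightarrow> nat \<Rightarrow> (nat \<Rightarrow> 'o) \<Rightarrow> (nat \<Rightarrow> 'm) \<Rightarrow> bool" where
  "admissibly_exact E X t C d \<longleftrightarrow>
     (if t = 0 then d 0 \<in> Hom E (C 0) X \<and> iso_arr E (d 0)
      else \<exists>Z j p. Z 0 = X \<and> Z t = C t \<and>
        (\<forall>i<t. j i \<in> Hom E (Z (Suc i)) (C i) \<and> p i \<in> Hom E (C i) (Z i) \<and> (j i, p i) \<in> Confl E) \<and>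
        d 0 = p 0 \<and> (\<forall>i. 0 < i \<and> i < t \<longrightarrow> d i = j (i - 1) \<cdot>\<^bsub>E\<^esub> p i) \<and> d t = j (t - 1))"

definition ddell ::
    "('o, 'm, 'x) exact_cat_scheme \<Rightarrow> ('o \<Rightarrow> 'm \<times> 'm) \<Rightarrow> nat \<Rightarrow> 'o \<Rightarrow> enat" where
  "ddell E S k X =
     Inf (enat ` {m. \<exists>t\<le>m. \<exists>C d. admissibly_exact E X t C d \<and>
                       (\<forall>i\<le>t. dell E S (i + k) (C i) \<le> enat (m - i))})"

end

theory Submission
  imports Defs
begin

text \<open>
  Let \<open>0 \<rightarrow> C\<^sub>t \<rightarrow> \<cdots> \<rightarrow> C\<^sub>0 \<rightarrow> Y \<rightarrow> 0\<close> be spliced from \<open>Z\<^sub>i\<^sub>+\<^sub>1 \<rightarrow> C\<^sub>i \<rightarrow> Z\<^sub>i\<close> and realise \<open>ddell Y = m\<close>.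
  If \<open>P\<^sub>i \<rightarrow> C\<^sub>i\<close> is the chosen projective deflation and \<open>L\<^sub>i\<close> the kernel of \<open>P\<^sub>i \<rightarrow> C\<^sub>i \<rightarrow> Z\<^sub>i\<close>, there are
  conflations \<open>\<Omega> C\<^sub>i \<rightarrow> L\<^sub>i \<rightarrow> Z\<^sub>i\<^sub>+\<^sub>1\<close> for \<open>i < t\<close>, and \<open>L\<^sub>t = \<Omega> C\<^sub>t\<close>. Pulling back \<open>P\<^sub>i\<^sub>+\<^sub>1 \<rightarrow> Z\<^sub>i\<^sub>+\<^sub>1\<close>
  along \<open>L\<^sub>i \<rightarrow> Z\<^sub>i\<^sub>+\<^sub>1\<close> gives conflations \<open>L\<^sub>i\<^sub>+\<^sub>1 \<rightarrow> G\<^sub>i \<rightarrow> L\<^sub>i\<close> with \<open>G\<^sub>i\<close> stably a retract of \<open>\<Omega> C\<^sub>i\<close>.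
  Finally, if \<open>W\<close> is the cokernel of \<open>X \<rightarrow> Y\<close>, the pullback \<open>D\<close> of \<open>P\<^sub>0 \<rightarrow> Y\<close> along \<open>X \<rightarrow> Y\<close> is the kernel of
  \<open>P\<^sub>0 \<rightarrow> W\<close>; so it is stably a retract of \<open>\<Omega> W\<close>, its \<open>1\<close>-delooping level is \<open>0\<close>, and it sits in a conflation
  \<open>L\<^sub>0 \<rightarrow> D \<rightarrow> X\<close>. Since \<open>(k + 1)\<close>-\<open>dell (\<Omega> C) \<le> k\<close>-\<open>dell C\<close>, the sequence
  \<open>0 \<rightarrow> L\<^sub>t \<rightarrow> G\<^sub>t\<^sub>-\<^sub>1 \<rightarrow> \<cdots> \<rightarrow> G\<^sub>0 \<rightarrow> D \<rightarrow> X \<rightarrow> 0\<close> shows \<open>ddell X \<le> m + 1\<close>.\<close>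

section \<open>Preadditive categories\<close>

lemma (in category) Hom_objs:
  assumes "f \<in> Hom C X Y"
  shows "X \<in> Obj C" "Y \<in> Obj C"
  using assms Dom_closed Cod_closed by (auto simp: Hom_def)

context preadditive_category
begin

lemma Add_closed: "f \<in> Hom A X Y \<Longrightarrow> g \<in> Hom A X Y \<Longrightarrow> Add A f g \<in> Hom A X Y"
  using monoid.m_closed[OF group.is_monoid[OF comm_group.axioms(2)[OF comm_group_Hom]], of X Y f g]
    Hom_objs[of f X Y]
  by (simp add: hom_group_def)

lemma Zero_closed: "X \<in> Obj A \<Longrightarrow> Y \<in> Obj A \<Longrightarrow> Zero A X Y \<in> Hom A X Y"
  using monoid.one_closed[OF group.is_monoid[OF comm_group.axioms(2)[OF comm_group_Hom]], of X Y]
  by (simp add: hom_group_def)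

lemma Add_Zero: "f \<in> Hom A X Y \<Longrightarrow> Add A f (Zero A X Y) = f"
  using monoid.r_one[OF group.is_monoid[OF comm_group.axioms(2)[OF comm_group_Hom]], of X Y f]
    Hom_objs[of f X Y]
  by (simp add: hom_group_def)

lemma Add_comm: "f \<in> Hom A X Y \<Longrightarrow> g \<in> Hom A X Y \<Longrightarrow> Add A f g = Add A g f"
  using comm_monoid.m_comm[OF comm_group.axioms(1)[OF comm_group_Hom], of X Y f g]
    Hom_objs[of f X Y]
  by (simp add: hom_group_def)

lemma Add_assoc:
  "f \<in> Hom A X Y \<Longrightarrow> g \<in> Hom A X Y \<Longrightarrow> h \<in> Hom A X Y \<Longrightarrow>
   Add A (Add A f g) h = Add A f (Add A g h)"
  using monoid.m_assoc[OF group.is_monoid[OF comm_group.axioms(2)[OF comm_group_Hom]], of X Y f g h]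
    Hom_objs[of f X Y]
  by (simp add: hom_group_def)

lemma Zero_Add: "f \<in> Hom A X Y \<Longrightarrow> Add A (Zero A X Y) f = f"
  using Add_comm[of "Zero A X Y" X Y f] Add_Zero Zero_closed Hom_objs[of f X Y] by simp

lemma ex_neg:
  assumes "f \<in> Hom A X Y"
  shows "\<exists>g \<in> Hom A X Y. Add A f g = Zero A X Y"
  using group.r_inv[OF comm_group.axioms(2)[OF comm_group_Hom], of X Y f]
    group.inv_closed[OF comm_group.axioms(2)[OF comm_group_Hom], of X Y f]
    Hom_objs[of f X Y] assms
  by (auto simp add: hom_group_def)

text \<open>Subtraction in existential form: no minus operation on Hom-sets is introduced, and later
  proofs write an identity as a given endomorphism plus a remainder.\<close>

lemma ex_diff:
  assumes f: "f \<in> Hom A X Y" and g: "g \<in> Hom A X Y"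
  shows "\<exists>h \<in> Hom A X Y. Add A g h = f"
proof -
  obtain n where n: "n \<in> Hom A X Y" "Add A g n = Zero A X Y"
    using ex_neg[OF g] by blast
  have "Add A g (Add A n f) = f"
    using Add_assoc[OF g n(1) f] Zero_Add[OF f] n(2) by simp
  then show ?thesis
    using Add_closed[OF n(1) f] by blast
qed

lemma Add_left_cancel:
  assumes f: "f \<in> Hom A X Y" and g: "g \<in> Hom A X Y" and h: "h \<in> Hom A X Y"
    and eq: "Add A f g = Add A f h"
  shows "g = h"
proof -
  obtain n where n: "n \<in> Hom A X Y" "Add A f n = Zero A X Y"
    using ex_neg[OF f] by blast
  have "Add A n f = Zero A X Y"
    using Add_comm[OF f n(1)] n(2) by simp
  then have "Add A n (Add A f k) = k" if "k \<in> Hom A X Y" for k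
    using Add_assoc[OF n(1) f that] Zero_Add[OF that] by simp
  then show ?thesis
    using g h eq by metis
qed

lemma Add_eq_self:
  assumes "f \<in> Hom A X Y" "g \<in> Hom A X Y" "Add A f g = f"
  shows "g = Zero A X Y"
  using Add_left_cancel[OF assms(1,2), of "Zero A X Y"] Add_Zero[OF assms(1)]
    Zero_closed Hom_objs[OF assms(1)] assms(3) by simp

lemma Comp_Zero:
  assumes g: "g \<in> Hom A Y Z" and X: "X \<in> Obj A"
  shows "g \<cdot> Zero A X Y = Zero A X Z"
proof -
  have z: "Zero A X Y \<in> Hom A X Y"
    using Zero_closed Hom_objs[OF g] X by blast
  show ?thesis
    using Add_eq_self[OF Comp_closed[OF z g] Comp_closed[OF z g]]
      Comp_Add[OF z z g] Add_Zero[OF z] by simp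
qed

lemma Zero_Comp:
  assumes f: "f \<in> Hom A X Y" and Z: "Z \<in> Obj A"
  shows "Zero A Y Z \<cdot> f = Zero A X Z"
proof -
  have z: "Zero A Y Z \<in> Hom A Y Z"
    using Zero_closed Hom_objs[OF f] Z by blast
  show ?thesis
    using Add_eq_self[OF Comp_closed[OF f z] Comp_closed[OF f z]]
      Add_Comp[OF f z z] Add_Zero[OF z] by simp
qed

lemma kernel_ofI:
  assumes i: "i \<in> Hom A X Y" and p: "p \<in> Hom A Y Z" and pi: "p \<cdot> i = Zero A X Z"
    and ex: "\<And>T f. f \<in> Hom A T Y \<Longrightarrow> p \<cdot> f = Zero A T Z \<Longrightarrow> \<exists>h \<in> Hom A T X. i \<cdot> h = f"
    and mono: "\<And>T g h. g \<in> Hom A T X \<Longrightarrow> h \<in> Hom A T X \<Longrightarrow> i \<cdot> g = i \<cdot> h \<Longrightarrow> g = h"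
  shows "kernel_of A p i"
proof -
  have eqs: "i \<in> Arr A" "Dom A i = X" "Cod A i = Y" "p \<in> Arr A" "Dom A p = Y" "Cod A p = Z"
    using i p by (auto simp: Hom_def)
  show ?thesis
    unfolding kernel_of_def eqs
  proof (intro conjI ballI impI)
    fix T f assume "f \<in> Hom A T Y" "p \<cdot> f = Zero A T Z"
    then obtain h where "h \<in> Hom A T X" "i \<cdot> h = f" using ex by blast
    then show "\<exists>!h. h \<in> Hom A T X \<and> i \<cdot> h = f" using mono by blast
  qed (use eqs pi in auto)
qed

lemma
  assumes k: "kernel_of A p i" and i: "i \<in> Hom A X Y" and p: "p \<in> Hom A Y Z"
  shows kernel_Comp: "p \<cdot> i = Zero A X Z"
    and kernel_lift: "f \<in> Hom A T Y \<Longrightarrow> p \<cdot> f = Zero A T Z \<Longrightarrow> \<exists>h \<in> Hom A T X. i \<cdot> h = f"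
    and kernel_mono: "g \<in> Hom A T X \<Longrightarrow> h \<in> Hom A T X \<Longrightarrow> i \<cdot> g = i \<cdot> h \<Longrightarrow> g = h"
proof -
  have eqs: "Dom A i = X" "Dom A p = Y" "Cod A p = Z"
    using i p by (auto simp: Hom_def)
  note k = k[unfolded kernel_of_def eqs]
  show pi: "p \<cdot> i = Zero A X Z" using k by blast
  show "\<exists>h \<in> Hom A T X. i \<cdot> h = f" if "f \<in> Hom A T Y" "p \<cdot> f = Zero A T Z"
    using k that Hom_objs by blast
  show "g = h" if g: "g \<in> Hom A T X" and h: "h \<in> Hom A T X" and e: "i \<cdot> g = i \<cdot> h"
  proof -
    have "p \<cdot> (i \<cdot> g) = Zero A T Z"
      using Comp_assoc[OF g i p] pi Zero_Comp[OF g] Hom_objs[OF p] by simp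
    then have "\<exists>!h. h \<in> Hom A T X \<and> i \<cdot> h = i \<cdot> g"
      using k Comp_closed[OF g i] Hom_objs[OF g] by blast
    then show ?thesis using g h e by metis
  qed
qed

lemma kernel_unique:
  assumes k: "kernel_of A p i" and i: "i \<in> Hom A X Y" and p: "p \<in> Hom A Y Z"
    and k': "kernel_of A p i'" and i': "i' \<in> Hom A X' Y"
  shows "\<exists>a \<in> Hom A X X'. iso_arr A a \<and> i' \<cdot> a = i"
proof -
  obtain a where a: "a \<in> Hom A X X'" "i' \<cdot> a = i"
    using kernel_lift[OF k' i' p i kernel_Comp[OF k i p]] by blast
  obtain b where b: "b \<in> Hom A X' X" "i \<cdot> b = i'"
    using kernel_lift[OF k i p i' kernel_Comp[OF k' i' p]] by blast
  have X: "X \<in> Obj A" "X' \<in> Obj A" using Hom_objs[OF a(1)] by auto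
  have "b \<cdot> a = Id A X"
    using kernel_mono[OF k i p Comp_closed[OF a(1) b(1)] Id_closed[OF X(1)]]
      Comp_assoc[OF a(1) b(1) i] a(2) b(2) Comp_Id[OF i] by simp
  moreover have "a \<cdot> b = Id A X'"
    using kernel_mono[OF k' i' p Comp_closed[OF b(1) a(1)] Id_closed[OF X(2)]]
      Comp_assoc[OF b(1) a(1) i'] a(2) b(2) Comp_Id[OF i'] by simp
  ultimately have "iso_arr A a"
    using a b by (auto simp: iso_arr_def Hom_def)
  then show ?thesis using a by blast
qed

end

lemma iso_arr_Id: "category C \<Longrightarrow> X \<in> Obj C \<Longrightarrow> iso_arr C (Id C X)"
  using category.Id_closed[of C X] category.Comp_Id[of C "Id C X" X X]
  by (auto simp: iso_arr_def Hom_def)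


section \<open>Pullbacks\<close>

lemma pullback_square_sym:
  assumes "pullback_square C i f i' f'"
  shows "pullback_square C f i f' i'"
proof -
  obtain A B A' B' where *: "i \<in> Hom C A B" "f \<in> Hom C A A'" "i' \<in> Hom C A' B'" "f' \<in> Hom C B B'"
    "f' \<cdot>\<^bsub>C\<^esub> i = i' \<cdot>\<^bsub>C\<^esub> f"
    and univ: "\<And>T b a. T \<in> Obj C \<Longrightarrow> b \<in> Hom C T B \<Longrightarrow> a \<in> Hom C T A' \<Longrightarrow> f' \<cdot>\<^bsub>C\<^esub> b = i' \<cdot>\<^bsub>C\<^esub> a \<Longrightarrow>
      \<exists>!h. h \<in> Hom C T A \<and> i \<cdot>\<^bsub>C\<^esub> h = b \<and> f \<cdot>\<^bsub>C\<^esub> h = a"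
    using assms unfolding pullback_square_def by blast
  show ?thesis
    unfolding pullback_square_def
  proof (intro exI conjI ballI impI)
    fix T a b assume "T \<in> Obj C" "a \<in> Hom C T A'" "b \<in> Hom C T B" "i' \<cdot>\<^bsub>C\<^esub> a = f' \<cdot>\<^bsub>C\<^esub> b"
    then show "\<exists>!h. h \<in> Hom C T A \<and> f \<cdot>\<^bsub>C\<^esub> h = a \<and> i \<cdot>\<^bsub>C\<^esub> h = b"
      using univ[of T b a] by (metis (no_types, lifting))
  qed (use * in auto)
qed

text \<open>\<open>pullback_square\<close> hides its corner objects behind an existential. Since an
  arrow determines its domain and codomain, the hidden corners agree with the given ones, and the
  universal property becomes usable for them.\<close>

lemma (in category)
  assumes pb: "pullback_square C i f i' f'" and i: "i \<in> Hom C A B" and f: "f \<in> Hom C A A'"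
  shows pullback_lift: "b \<in> Hom C T B \<Longrightarrow> a \<in> Hom C T A' \<Longrightarrow> f' \<cdot> b = i' \<cdot> a \<Longrightarrow>
      \<exists>h \<in> Hom C T A. i \<cdot> h = b \<and> f \<cdot> h = a"
    and pullback_mono: "g \<in> Hom C T A \<Longrightarrow> h \<in> Hom C T A \<Longrightarrow> i \<cdot> g = i \<cdot> h \<Longrightarrow> f \<cdot> g = f \<cdot> h \<Longrightarrow> g = h"
    and pullback_commutes: "f' \<cdot> i = i' \<cdot> f"
proof -
  have eq: "Dom C i = A" "Cod C i = B" "Cod C f = A'" using i f by (auto simp: Hom_def)
  obtain B' where *: "i' \<in> Hom C A' B'" "f' \<in> Hom C B B'" "f' \<cdot> i = i' \<cdot> f"
    and univ: "\<forall>T \<in> Obj C. \<forall>b \<in> Hom C T B. \<forall>a \<in> Hom C T A'. f' \<cdot> b = i' \<cdot> a \<longrightarrow>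
      (\<exists>!h. h \<in> Hom C T A \<and> i \<cdot> h = b \<and> f \<cdot> h = a)"
  proof -
    obtain A0 B0 A0' B' where 0: "i \<in> Hom C A0 B0" "f \<in> Hom C A0 A0'"
      and r: "i' \<in> Hom C A0' B'" "f' \<in> Hom C B0 B'" "f' \<cdot> i = i' \<cdot> f"
      "\<forall>T \<in> Obj C. \<forall>b \<in> Hom C T B0. \<forall>a \<in> Hom C T A0'. f' \<cdot> b = i' \<cdot> a \<longrightarrow>
      (\<exists>!h. h \<in> Hom C T A0 \<and> i \<cdot> h = b \<and> f \<cdot> h = a)"
      using pb unfolding pullback_square_def by blast
    have "A0 = A" "B0 = B" "A0' = A'" using 0 eq by (auto simp: Hom_def)
    with r show thesis using that by blast
  qed
  show "f' \<cdot> i = i' \<cdot> f" by (fact *)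
  show "\<exists>h \<in> Hom C T A. i \<cdot> h = b \<and> f \<cdot> h = a"
    if "b \<in> Hom C T B" "a \<in> Hom C T A'" "f' \<cdot> b = i' \<cdot> a"
    using univ that Hom_objs(1)[OF that(1)] by blast
  show "g = h" if g: "g \<in> Hom C T A" and h: "h \<in> Hom C T A"
    and e: "i \<cdot> g = i \<cdot> h" "f \<cdot> g = f \<cdot> h"
  proof -
    have "f' \<cdot> (i \<cdot> g) = i' \<cdot> (f \<cdot> g)"
      using Comp_assoc[OF g i *(2)] Comp_assoc[OF g f *(1)] *(3) by simp
    then have "\<exists>!h. h \<in> Hom C T A \<and> i \<cdot> h = i \<cdot> g \<and> f \<cdot> h = f \<cdot> g"
      using univ Comp_closed[OF g i] Comp_closed[OF g f] Hom_objs[OF g] by blast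
    then show ?thesis using g h e by metis
  qed
qed

context preadditive_category
begin

text \<open>Parallel arrows of a pullback square have the same kernel object: if \<open>i\<close>
  kills \<open>g\<close>, then \<open>i'\<close> kills \<open>f \<cdot> g\<close>, which therefore
  factors through \<open>k\<close>; and \<open>g\<close> is recovered from
  \<open>f \<cdot> g\<close> together with the zero map to \<open>B\<close>.\<close>

lemma pullback_kernel:
  assumes pb: "pullback_square A i f i' f'"
    and i: "i \<in> Hom A X B" and f: "f \<in> Hom A X X'" and i': "i' \<in> Hom A X' B'" and f': "f' \<in> Hom A B B'"
    and ker: "kernel_of A i' k" and k: "k \<in> Hom A K X'"
  shows "\<exists>k' \<in> Hom A K X. f \<cdot> k' = k \<and> kernel_of A i k'"
proof -
  note lift = pullback_lift[OF pb i f] and mono = pullback_mono[OF pb i f]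
    and comm = pullback_commutes[OF pb i f]
  have obj: "K \<in> Obj A" "B \<in> Obj A" "B' \<in> Obj A"
    using Hom_objs[OF k] Hom_objs[OF f'] by auto
  obtain k' where k': "k' \<in> Hom A K X" "i \<cdot> k' = Zero A K B" "f \<cdot> k' = k"
    using lift[OF Zero_closed[OF obj(1,2)] k] Comp_Zero[OF f' obj(1)] kernel_Comp[OF ker k i'] by auto
  have "kernel_of A i k'"
  proof (rule kernel_ofI[OF k'(1) i k'(2)])
    fix T g assume g: "g \<in> Hom A T X" "i \<cdot> g = Zero A T B"
    have fg: "f \<cdot> g \<in> Hom A T X'" by (rule Comp_closed[OF g(1) f])
    have "i' \<cdot> (f \<cdot> g) = Zero A T B'"
      using Comp_assoc[OF g(1) f i'] Comp_assoc[OF g(1) i f'] comm g(2)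
        Comp_Zero[OF f' Hom_objs(1)[OF g(1)]] by simp
    then obtain h where h: "h \<in> Hom A T K" "k \<cdot> h = f \<cdot> g"
      using kernel_lift[OF ker k i' fg] by blast
    have "k' \<cdot> h = g"
      using mono[OF Comp_closed[OF h(1) k'(1)] g(1)] Comp_assoc[OF h(1) k'(1) i]
        Comp_assoc[OF h(1) k'(1) f] k'(2,3) h(2) g(2) Zero_Comp[OF h(1) obj(2)] by simp
    then show "\<exists>h \<in> Hom A T K. k' \<cdot> h = g" using h(1) by blast
  next
    fix T g h assume gh: "g \<in> Hom A T K" "h \<in> Hom A T K" "k' \<cdot> g = k' \<cdot> h"
    then have "k \<cdot> g = k \<cdot> h"
      using Comp_assoc[OF gh(1) k'(1) f] Comp_assoc[OF gh(2) k'(1) f] k'(3) by simp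
    then show "g = h" by (rule kernel_mono[OF ker k i' gh(1,2)])
  qed
  then show ?thesis using k' by blast
qed

end


section \<open>Conflations\<close>

context exact_category
begin

lemma ConflD:
  assumes "(i, p) \<in> Confl E" "i \<in> Hom E X Y" "p \<in> Hom E Y' Z"
  shows "kernel_of E p i" "Y' = Y"
  using Confl_kernel[OF assms(1)] assms(2,3) by (auto simp: kernel_of_def Hom_def)

lemma Confl_Hom:
  assumes "(i, p) \<in> Confl E"
  shows "i \<in> Hom E (Dom E i) (Dom E p)" "p \<in> Hom E (Dom E p) (Cod E p)"
  using Confl_kernel[OF assms] by (auto simp: kernel_of_def Hom_def)

lemma category_E: "category E"
  by unfold_locales

text \<open>A deflation comes with some kernel in a conflation; any other kernel is isomorphic to it
  over \<open>Y\<close>, and conflations are closed under isomorphism.\<close>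

lemma deflation_kernel_Confl:
  assumes d: "deflation E p" and p: "p \<in> Hom E Y Z" and k: "kernel_of E p i" and i: "i \<in> Hom E X Y"
  shows "(i, p) \<in> Confl E"
proof -
  obtain j where j: "(j, p) \<in> Confl E" using d by (auto simp: deflation_def)
  have eq: "Dom E p = Y" "Cod E p = Z" using p by (auto simp: Hom_def)
  have jH: "j \<in> Hom E (Dom E j) Y" using Confl_Hom[OF j] eq by simp
  then have cj: "Cod E j = Y" by (simp add: Hom_def)
  obtain a where a: "a \<in> Hom E (Dom E j) X" "iso_arr E a" "i \<cdot> a = j"
    using kernel_unique[OF Confl_kernel[OF j] jH p k i] by blast
  have o: "Y \<in> Obj E" "Z \<in> Obj E" using Hom_objs[OF p] by auto
  show ?thesis
    by (rule Confl_iso[OF j i p a(1) _ _ a(2) iso_arr_Id[OF category_E o(1)] iso_arr_Id[OF category_E o(2)]])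
      (use cj eq Id_closed o a(3) Id_Comp[OF jH] Id_Comp[OF p] Comp_Id[OF p] in auto)
qed

lemma Confl_pullback:
  assumes c: "(k, p) \<in> Confl E" and k: "k \<in> Hom E K Y" and p: "p \<in> Hom E Y Z"
    and f: "f \<in> Hom E Z' Z"
  shows "\<exists>L p' f' k'. p' \<in> Hom E L Z' \<and> f' \<in> Hom E L Y \<and> k' \<in> Hom E K L \<and>
    pullback_square E p' f' p f \<and> (k', p') \<in> Confl E"
proof -
  have "deflation E p" using c by (auto simp: deflation_def)
  then obtain p' f' where pb: "pullback_square E p' f' p f" and d: "deflation E p'"
    using deflation_pullback[OF p _ f] by blast
  obtain L where L: "p' \<in> Hom E L Z'" "f' \<in> Hom E L Y"
  proof -
    obtain L B A' B' where "p' \<in> Hom E L B" "f' \<in> Hom E L A'" "p \<in> Hom E A' B'" "f \<in> Hom E B B'"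
      using pb unfolding pullback_square_def by blast
    then show thesis using that p f by (auto simp: Hom_def)
  qed
  obtain k' where "k' \<in> Hom E K L" "kernel_of E p' k'"
    using pullback_kernel[OF pb L p f ConflD(1)[OF c k p] k] by blast
  then show ?thesis
    using deflation_kernel_Confl[OF d L(1)] L pb by blast
qed

text \<open>The rotation of \<open>X \<rightarrow> Y \<rightarrow> Z\<close> along \<open>P \<rightarrow> Y\<close>: with \<open>P\<close> projective, \<open>L\<close> is a syzygy of \<open>Z\<close>
  and \<open>K\<close> one of \<open>Y\<close>.\<close>

lemma rotation:
  assumes c: "(i, q) \<in> Confl E" and i: "i \<in> Hom E X Y" and q: "q \<in> Hom E Y Z"
    and c': "(k, p) \<in> Confl E" and k: "k \<in> Hom E K P" and p: "p \<in> Hom E P Y"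
  shows "\<exists>L l k' p'. l \<in> Hom E L P \<and> (l, q \<cdot> p) \<in> Confl E \<and>
    k' \<in> Hom E K L \<and> p' \<in> Hom E L X \<and> (k', p') \<in> Confl E"
proof -
  \<comment> \<open>\<open>L\<close> is the pullback of \<open>p\<close> along \<open>i\<close>; the
    deflation \<open>p'\<close> inherits the kernel \<open>K\<close> of \<open>p\<close>.\<close>
  obtain L p' l k' where p': "p' \<in> Hom E L X" and l: "l \<in> Hom E L P" and k': "k' \<in> Hom E K L"
    and pb: "pullback_square E p' l p i" and c'': "(k', p') \<in> Confl E"
    using Confl_pullback[OF c' k p i] by blast
  note lift = pullback_lift[OF pb p' l] and mono = pullback_mono[OF pb p' l]
    and comm = pullback_commutes[OF pb p' l]
  have qp: "q \<cdot> p \<in> Hom E P Z" by (rule Comp_closed[OF p q])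
  note ker = ConflD(1)[OF c i q]
  \<comment> \<open>If \<open>q \<cdot> p\<close> kills \<open>f\<close>, then
    \<open>p \<cdot> f\<close> factors through \<open>i\<close>, the kernel of \<open>q\<close>;
    this factor and \<open>f\<close> together define a map into the pullback
    \<open>L\<close>.\<close>
  have "kernel_of E (q \<cdot> p) l"
  proof (rule kernel_ofI[OF l qp])
    show "q \<cdot> p \<cdot> l = Zero E L Z"
      using Comp_assoc[OF l p q] comm Comp_assoc[OF p' i q] kernel_Comp[OF ker i q]
        Zero_Comp[OF p'] Hom_objs[OF q] by simp
  next
    fix T f assume f: "f \<in> Hom E T P" "q \<cdot> p \<cdot> f = Zero E T Z"
    then have "q \<cdot> (p \<cdot> f) = Zero E T Z" using Comp_assoc[OF f(1) p q] by simp
    then obtain h where h: "h \<in> Hom E T X" "i \<cdot> h = p \<cdot> f"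
      using kernel_lift[OF ker i q Comp_closed[OF f(1) p]] by blast
    show "\<exists>h \<in> Hom E T L. l \<cdot> h = f" using lift[OF h(1) f(1) h(2)] by blast
  next
    fix T g h assume gh: "g \<in> Hom E T L" "h \<in> Hom E T L" "l \<cdot> g = l \<cdot> h"
    have "i \<cdot> (p' \<cdot> g) = i \<cdot> (p' \<cdot> h)"
      using Comp_assoc[OF gh(1) p' i] Comp_assoc[OF gh(2) p' i] comm
        Comp_assoc[OF gh(1) l p] Comp_assoc[OF gh(2) l p] gh(3) by metis
    then have "p' \<cdot> g = p' \<cdot> h"
      by (rule kernel_mono[OF ker i q Comp_closed[OF gh(1) p'] Comp_closed[OF gh(2) p']])
    then show "g = h" using mono[OF gh(1,2)] gh(3) by blast
  qed
  moreover have "deflation E (q \<cdot> p)"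
    using deflation_Comp[OF p q] c c' by (auto simp: deflation_def)
  ultimately show ?thesis
    using deflation_kernel_Confl[OF _ qp _ l] l k' p' c'' by blast
qed

end

section \<open>Projective objects and the stable category\<close>

context exact_category
begin

lemma projective_lift:
  assumes P: "projective E P" and p: "deflation E p" "p \<in> Hom E Y Z" and f: "f \<in> Hom E P Z"
  shows "\<exists>g \<in> Hom E P Y. p \<cdot> g = f"
proof -
  have "Dom E p = Y" "Cod E p = Z" using p(2) by (auto simp: Hom_def)
  then show ?thesis using P p(1) f unfolding projective_def by blast
qed

lemma projective_Obj: "projective E P \<Longrightarrow> P \<in> Obj E"
  by (simp add: projective_def)

lemma projective_zero_object:
  assumes Z: "zero_object E Z"
  shows "projective E Z"
  unfolding projective_def
proof (intro conjI allI impI ballI)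
  show O: "Z \<in> Obj E" using Z by (simp add: zero_object_def)
  fix p f assume d: "deflation E p" and f: "f \<in> Hom E Z (Cod E p)"
  then have p: "p \<in> Hom E (Dom E p) (Cod E p)" using Confl_Hom(2) by (auto simp: deflation_def)
  obtain g where g: "g \<in> Hom E Z (Dom E p)"
    using Z Hom_objs(1)[OF p] unfolding zero_object_def by blast
  have "p \<cdot> g = f"
    using Comp_closed[OF g p] f Z Hom_objs(2)[OF p] unfolding zero_object_def by blast
  then show "\<exists>g \<in> Hom E Z (Dom E p). p \<cdot> g = f" using g by blast
qed

lemma projective_biproduct:
  assumes P: "projective E P" and Q: "projective E Q" and B: "biproduct E P Q B i j p q"
  shows "projective E B"
  unfolding projective_def
proof (intro conjI allI impI ballI)
  show "B \<in> Obj E" using B by (simp add: biproduct_def)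
  have h: "i \<in> Hom E P B" "j \<in> Hom E Q B" "p \<in> Hom E B P" "q \<in> Hom E B Q"
    and one: "Add E (i \<cdot> p) (j \<cdot> q) = Id E B"
    using B by (auto simp: biproduct_def)
  fix d f assume d: "deflation E d" and f: "f \<in> Hom E B (Cod E d)"
  then have dH: "d \<in> Hom E (Dom E d) (Cod E d)" using Confl_Hom(2) by (auto simp: deflation_def)
  obtain a where a: "a \<in> Hom E P (Dom E d)" "d \<cdot> a = f \<cdot> i"
    using projective_lift[OF P d dH Comp_closed[OF h(1) f]] by blast
  obtain b where b: "b \<in> Hom E Q (Dom E d)" "d \<cdot> b = f \<cdot> j"
    using projective_lift[OF Q d dH Comp_closed[OF h(2) f]] by blast
  have "d \<cdot> Add E (a \<cdot> p) (b \<cdot> q) = Add E (d \<cdot> a \<cdot> p) (d \<cdot> b \<cdot> q)"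
    using Comp_Add[OF Comp_closed[OF h(3) a(1)] Comp_closed[OF h(4) b(1)] dH]
      Comp_assoc[OF h(3) a(1) dH] Comp_assoc[OF h(4) b(1) dH] by simp
  also have "\<dots> = f \<cdot> Add E (i \<cdot> p) (j \<cdot> q)"
    using Comp_Add[OF Comp_closed[OF h(3,1)] Comp_closed[OF h(4,2)] f]
      Comp_assoc[OF h(3,1) f] Comp_assoc[OF h(4,2) f] a(2) b(2) by simp
  also have "\<dots> = f" using one Comp_Id[OF f] by simp
  finally show "\<exists>g \<in> Hom E B (Dom E d). d \<cdot> g = f"
    using Add_closed[OF Comp_closed[OF h(3) a(1)] Comp_closed[OF h(4) b(1)]] by blast
qed

section \<open>The ideal of maps factoring through projectives\<close>

lemma proj_factoringI:
  "projective E P \<Longrightarrow> a \<in> Hom E X P \<Longrightarrow> b \<in> Hom E P Y \<Longrightarrow> b \<cdot> a \<in> proj_factoring E X Y"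
  by (auto simp: proj_factoring_def)

lemma proj_factoring_Hom: "h \<in> proj_factoring E X Y \<Longrightarrow> h \<in> Hom E X Y"
  using Comp_closed by (auto simp: proj_factoring_def)

lemma proj_factoring_Comp:
  assumes "h \<in> proj_factoring E X Y" "g \<in> Hom E Y Z"
  shows "g \<cdot> h \<in> proj_factoring E X Z"
proof -
  obtain a b P where "projective E P" "a \<in> Hom E X P" "b \<in> Hom E P Y" "h = b \<cdot> a"
    using assms(1) by (auto simp: proj_factoring_def)
  then show ?thesis
    using Comp_assoc[of a X P b Y g Z] proj_factoringI[of P a X "g \<cdot> b" Z] Comp_closed assms(2)
    by auto
qed

lemma Comp_proj_factoring:
  assumes "h \<in> proj_factoring E Y Z" "f \<in> Hom E X Y"
  shows "h \<cdot> f \<in> proj_factoring E X Z"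
proof -
  obtain a b P where "projective E P" "a \<in> Hom E Y P" "b \<in> Hom E P Z" "h = b \<cdot> a"
    using assms(1) by (auto simp: proj_factoring_def)
  then show ?thesis
    using Comp_assoc[of f X Y a P b Z] proj_factoringI[of P "a \<cdot> f" X b Z] Comp_closed assms(2)
    by (metis (no_types, lifting))
qed

lemma proj_factoring_Add:
  assumes "g \<in> proj_factoring E X Y" "h \<in> proj_factoring E X Y"
  shows "Add E g h \<in> proj_factoring E X Y"
proof -
  obtain a b P where P: "projective E P" and ab: "a \<in> Hom E X P" "b \<in> Hom E P Y" "g = b \<cdot> a"
    using assms(1) by (auto simp: proj_factoring_def)
  obtain c d Q where Q: "projective E Q" and cd: "c \<in> Hom E X Q" "d \<in> Hom E Q Y" "h = d \<cdot> c"
    using assms(2) by (auto simp: proj_factoring_def)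
  obtain B i j p q where B: "biproduct E P Q B i j p q"
    using ex_biproduct P Q projective_Obj by blast
  then have m: "i \<in> Hom E P B" "j \<in> Hom E Q B" "p \<in> Hom E B P" "q \<in> Hom E B Q"
    and e: "p \<cdot> i = Id E P" "q \<cdot> j = Id E Q" "q \<cdot> i = Zero E P Q" "p \<cdot> j = Zero E Q P"
    by (auto simp: biproduct_def)
  \<comment> \<open>The sum factors through the biproduct \<open>B\<close> of \<open>P\<close> and
    \<open>Q\<close>: \<open>s\<close> is the column with entries \<open>a\<close>,
    \<open>c\<close>, and \<open>r\<close> is the row with entries \<open>b\<close>,
    \<open>d\<close>.\<close>
  define s where "s = Add E (i \<cdot> a) (j \<cdot> c)"
  define r where "r = Add E (b \<cdot> p) (d \<cdot> q)"
  have H: "i \<cdot> a \<in> Hom E X B" "j \<cdot> c \<in> Hom E X B" "b \<cdot> p \<in> Hom E B Y" "d \<cdot> q \<in> Hom E B Y"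
    using m ab cd Comp_closed by blast+
  have s: "s \<in> Hom E X B" and r: "r \<in> Hom E B Y"
    using H Add_closed by (auto simp: s_def r_def)
  have ps: "p \<cdot> s = a"
    unfolding s_def
    using Comp_Add[OF H(1,2) m(3)] Comp_assoc[OF ab(1) m(1,3)] Comp_assoc[OF cd(1) m(2,3)] e
      Id_Comp[OF ab(1)] Zero_Comp[OF cd(1)] projective_Obj[OF P] Add_Zero[OF ab(1)] by simp
  have qs: "q \<cdot> s = c"
    unfolding s_def
    using Comp_Add[OF H(1,2) m(4)] Comp_assoc[OF ab(1) m(1,4)] Comp_assoc[OF cd(1) m(2,4)] e
      Id_Comp[OF cd(1)] Zero_Comp[OF ab(1)] projective_Obj[OF Q] Zero_Add[OF cd(1)] by simp
  have "r \<cdot> s = Add E g h"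
    unfolding r_def
    using Add_Comp[OF s H(3,4)] Comp_assoc[OF s m(3) ab(2)] Comp_assoc[OF s m(4) cd(2)] ps qs
      ab(3) cd(3) by simp
  then show ?thesis
    using proj_factoringI[OF projective_biproduct[OF P Q B] s r] by simp
qed

lemma Zero_proj_factoring:
  assumes "X \<in> Obj E" "Y \<in> Obj E"
  shows "Zero E X Y \<in> proj_factoring E X Y"
proof -
  obtain Z where Z: "zero_object E Z" using ex_zero_object by blast
  then have O: "Z \<in> Obj E" by (simp add: zero_object_def)
  show ?thesis
    using proj_factoringI[OF projective_zero_object[OF Z] Zero_closed[OF assms(1) O] Zero_closed[OF O assms(2)]]
      Comp_Zero[OF Zero_closed[OF O assms(2)] assms(1)] by simp
qed

text \<open>The negative is composition with minus the identity of \<open>Y\<close>, which preserves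
  factoring through a projective.\<close>

lemma proj_factoring_neg:
  assumes "h \<in> proj_factoring E X Y"
  shows "\<exists>n \<in> proj_factoring E X Y. Add E n h = Zero E X Y"
proof -
  have h: "h \<in> Hom E X Y" by (rule proj_factoring_Hom[OF assms])
  then have Y: "Y \<in> Obj E" by (rule Hom_objs)
  obtain n where n: "n \<in> Hom E Y Y" "Add E (Id E Y) n = Zero E Y Y"
    using ex_neg[OF Id_closed[OF Y]] by blast
  have "Add E (n \<cdot> h) h = Add E n (Id E Y) \<cdot> h"
    using Add_Comp[OF h n(1) Id_closed[OF Y]] Id_Comp[OF h] by simp
  also have "\<dots> = Zero E X Y"
    using n Add_comm[OF n(1) Id_closed[OF Y]] Zero_Comp[OF h Y] by simp
  finally show ?thesis using proj_factoring_Comp[OF assms n(1)] by blast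
qed

section \<open>Stable morphisms as cosets\<close>

lemma in_stable_class_iff:
  assumes "f \<in> Hom E X Y"
  shows "g \<in> stable_class E f \<longleftrightarrow> (\<exists>h \<in> proj_factoring E X Y. g = Add E h f)"
proof -
  have "Dom E f = X" "Cod E f = Y" using assms by (auto simp: Hom_def)
  then show ?thesis by (auto simp: stable_class_def r_coset_def hom_group_def)
qed

lemma stable_class_Hom: "g \<in> stable_class E f \<Longrightarrow> f \<in> Hom E X Y \<Longrightarrow> g \<in> Hom E X Y"
  using in_stable_class_iff Add_closed proj_factoring_Hom by metis

lemma self_in_stable_class: "f \<in> Hom E X Y \<Longrightarrow> f \<in> stable_class E f"
  using in_stable_class_iff[of f X Y f] Zero_proj_factoring Hom_objs[of f X Y] Zero_Add[of f X Y]
  by force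

lemma stable_class_trans:
  assumes f: "f \<in> Hom E X Y" and "g \<in> stable_class E f" and "h \<in> stable_class E g"
  shows "h \<in> stable_class E f"
proof -
  have g: "g \<in> Hom E X Y" by (rule stable_class_Hom[OF assms(2) f])
  obtain a where a: "a \<in> proj_factoring E X Y" "g = Add E a f"
    using in_stable_class_iff[OF f] assms(2) by blast
  obtain b where b: "b \<in> proj_factoring E X Y" "h = Add E b g"
    using in_stable_class_iff[OF g] assms(3) by blast
  have "h = Add E (Add E b a) f"
    using a b Add_assoc[OF proj_factoring_Hom[OF b(1)] proj_factoring_Hom[OF a(1)] f] by simp
  then show ?thesis
    using in_stable_class_iff[OF f] proj_factoring_Add a(1) b(1) by blast
qed

lemma stable_class_sym:
  assumes f: "f \<in> Hom E X Y" and "g \<in> stable_class E f"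
  shows "f \<in> stable_class E g"
proof -
  have g: "g \<in> Hom E X Y" by (rule stable_class_Hom[OF assms(2) f])
  obtain a where a: "a \<in> proj_factoring E X Y" "g = Add E a f"
    using in_stable_class_iff[OF f] assms(2) by blast
  obtain n where n: "n \<in> proj_factoring E X Y" "Add E n a = Zero E X Y"
    using proj_factoring_neg[OF a(1)] by blast
  have "f = Add E n g"
    using a n Add_assoc[of n X Y a f] f proj_factoring_Hom Zero_Add[OF f] by simp
  then show ?thesis using in_stable_class_iff[OF g] n(1) by blast
qed

lemma stable_class_eq_iff:
  assumes "f \<in> Hom E X Y" "g \<in> Hom E X Y"
  shows "stable_class E f = stable_class E g \<longleftrightarrow> f \<in> stable_class E g"
  using assms stable_class_sym stable_class_trans self_in_stable_class by blast

text \<open>The two composites differ by \<open>b \<cdot> u'\<close> plus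
  \<open>v \<cdot> a\<close>, and both terms lie in the ideal. Hence composition in
  \<open>stable_category\<close> does not depend on the representatives picked by
  \<open>SOME\<close>.\<close>

lemma stable_class_Comp:
  assumes u: "u \<in> Hom E X Y" and v: "v \<in> Hom E Y Z"
    and u': "u' \<in> stable_class E u" and v': "v' \<in> stable_class E v"
  shows "v' \<cdot> u' \<in> stable_class E (v \<cdot> u)"
proof -
  obtain a where a: "a \<in> proj_factoring E X Y" "u' = Add E a u"
    using in_stable_class_iff[OF u] u' by blast
  obtain b where b: "b \<in> proj_factoring E Y Z" "v' = Add E b v"
    using in_stable_class_iff[OF v] v' by blast
  note H = proj_factoring_Hom[OF a(1)] proj_factoring_Hom[OF b(1)]
  have uH: "u' \<in> Hom E X Y" by (rule stable_class_Hom[OF u' u])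
  have "v' \<cdot> u' = Add E (b \<cdot> u') (Add E (v \<cdot> a) (v \<cdot> u))"
    using Add_Comp[OF uH H(2) v] Comp_Add[OF H(1) u v] a(2) b(2) by simp
  also have "\<dots> = Add E (Add E (b \<cdot> u') (v \<cdot> a)) (v \<cdot> u)"
    using Add_assoc[OF Comp_closed[OF uH H(2)] Comp_closed[OF H(1) v] Comp_closed[OF u v]] by simp
  finally show ?thesis
    using in_stable_class_iff[OF Comp_closed[OF u v]]
      proj_factoring_Add[OF Comp_proj_factoring[OF b(1) uH] proj_factoring_Comp[OF a(1) v]] by blast
qed

lemma some_in_stable_class: "f \<in> Hom E X Y \<Longrightarrow> (SOME g. g \<in> stable_class E f) \<in> stable_class E f"
  by (rule someI) (rule self_in_stable_class)

text \<open>Domain and codomain of a coset are read off a chosen representative, and every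
  representative lies in the Hom-set of the original map.\<close>

lemma Hom_stable_category: "Hom (stable_category E) X Y = stable_class E ` Hom E X Y"
proof -
  have *: "(SOME g. g \<in> stable_class E f) \<in> Hom E (Dom E f) (Cod E f)" if "f \<in> Arr E" for f
    using that some_in_stable_class[of f "Dom E f" "Cod E f"]
      stable_class_Hom[of _ f "Dom E f" "Cod E f"] by (auto simp: Hom_def)
  then have "Dom E (SOME g. g \<in> stable_class E f) = Dom E f"
    "Cod E (SOME g. g \<in> stable_class E f) = Cod E f" if "f \<in> Arr E" for f
    using that by (auto simp: Hom_def)
  then show ?thesis by (auto simp: Hom_def stable_category_def)
qed

text \<open>Removes the stable category from all later arguments: a stable retraction is a pair of
  maps of \<open>E\<close> whose composite differs from the identity by a map through a
  projective.\<close>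

lemma stable_retract_iff:
  assumes X: "X \<in> Obj E"
  shows "stable_retract E X Y \<longleftrightarrow>
    (\<exists>u \<in> Hom E X Y. \<exists>v \<in> Hom E Y X. \<exists>h \<in> proj_factoring E X X. Id E X = Add E h (v \<cdot> u))"
    (is "_ \<longleftrightarrow> ?R")
proof
  assume "stable_retract E X Y"
  then obtain u v where uv: "u \<in> Hom E X Y" "v \<in> Hom E Y X"
    and eq: "stable_class E ((SOME g. g \<in> stable_class E v) \<cdot> (SOME f. f \<in> stable_class E u)) =
      stable_class E (Id E X)"
    unfolding retract_of_def Hom_stable_category by (auto simp: stable_category_def)
  let ?u = "SOME f. f \<in> stable_class E u" and ?v = "SOME g. g \<in> stable_class E v"
  \<comment> \<open>Stable composition is computed on the selected representatives, so these serve
    as the two witnesses.\<close>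
  have H: "?u \<in> Hom E X Y" "?v \<in> Hom E Y X"
    using uv some_in_stable_class stable_class_Hom by metis+
  have "Id E X \<in> stable_class E (?v \<cdot> ?u)"
    using eq self_in_stable_class[OF Id_closed[OF X]] by simp
  then show ?R using in_stable_class_iff[OF Comp_closed[OF H]] H by blast
next
  assume ?R
  then obtain u v where uv: "u \<in> Hom E X Y" "v \<in> Hom E Y X" and "Id E X \<in> stable_class E (v \<cdot> u)"
    using in_stable_class_iff[OF Comp_closed] by metis
  then have 1: "stable_class E (v \<cdot> u) = stable_class E (Id E X)"
    using stable_class_eq_iff[OF Id_closed[OF X] Comp_closed[OF uv]] by simp
  let ?u = "SOME f. f \<in> stable_class E u" and ?v = "SOME g. g \<in> stable_class E v"
  have "?v \<cdot> ?u \<in> stable_class E (v \<cdot> u)"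
    by (rule stable_class_Comp[OF uv some_in_stable_class[OF uv(1)] some_in_stable_class[OF uv(2)]])
  then have "stable_class E (?v \<cdot> ?u) = stable_class E (v \<cdot> u)"
    using stable_class_eq_iff stable_class_Hom Comp_closed[OF uv] by blast
  then have "Comp (stable_category E) (stable_class E v) (stable_class E u) = Id (stable_category E) X"
    using 1 by (simp add: stable_category_def)
  then show "stable_retract E X Y"
    unfolding retract_of_def Hom_stable_category using uv by blast
qed

section \<open>Stable retracts and kernels of projective deflations\<close>

lemma stable_retract_refl:
  assumes X: "X \<in> Obj E"
  shows "stable_retract E X X"
  using stable_retract_iff[OF X] Id_closed[OF X] Zero_proj_factoring[OF X X]
    Zero_Add[OF Id_closed[OF X]] Comp_Id[OF Id_closed[OF X]] by force

text \<open>Substituting \<open>h' + v'u'\<close> for the identity of \<open>Y\<close> in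
  \<open>1 = h + vu\<close> gives \<open>1 = (h + vh'u) + (vv')(u'u)\<close>, whose bracketed first
  term still factors through projectives.\<close>

lemma stable_retract_trans:
  assumes X: "X \<in> Obj E" and XY: "stable_retract E X Y" and YZ: "stable_retract E Y Z"
  shows "stable_retract E X Z"
proof -
  obtain u v h where u: "u \<in> Hom E X Y" and v: "v \<in> Hom E Y X" and h: "h \<in> proj_factoring E X X"
    and 1: "Id E X = Add E h (v \<cdot> u)"
    using XY stable_retract_iff[OF X] by blast
  have Y: "Y \<in> Obj E" using Hom_objs[OF u] by simp
  obtain u' v' h' where u': "u' \<in> Hom E Y Z" and v': "v' \<in> Hom E Z Y" and h': "h' \<in> proj_factoring E Y Y"
    and 2: "Id E Y = Add E h' (v' \<cdot> u')"
    using YZ stable_retract_iff[OF Y] by blast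
  note hH = proj_factoring_Hom[OF h] and hH' = proj_factoring_Hom[OF h']
  have uu: "u' \<cdot> u \<in> Hom E X Z" and vv: "v \<cdot> v' \<in> Hom E Z X" and vu': "v' \<cdot> u' \<in> Hom E Y Y"
    using u u' v v' Comp_closed by blast+
  have hu: "h' \<cdot> u \<in> Hom E X Y" and vuu: "v' \<cdot> (u' \<cdot> u) \<in> Hom E X Y"
    using Comp_closed[OF u hH'] Comp_closed[OF uu v'] by auto
  have "u = Add E (h' \<cdot> u) (v' \<cdot> (u' \<cdot> u))"
    using Id_Comp[OF u] 2 Add_Comp[OF u hH' vu'] Comp_assoc[OF u u' v'] by simp
  then have "v \<cdot> u = Add E (v \<cdot> (h' \<cdot> u)) (v \<cdot> v' \<cdot> (u' \<cdot> u))"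
    using Comp_Add[OF hu vuu v] Comp_assoc[OF uu v' v] by simp
  then have "Id E X = Add E (Add E h (v \<cdot> (h' \<cdot> u))) (v \<cdot> v' \<cdot> (u' \<cdot> u))"
    using 1 Add_assoc[OF hH Comp_closed[OF hu v] Comp_closed[OF uu vv]] by simp
  moreover have "Add E h (v \<cdot> (h' \<cdot> u)) \<in> proj_factoring E X X"
    using proj_factoring_Add[OF h proj_factoring_Comp[OF Comp_proj_factoring[OF h' u] v]] .
  ultimately show ?thesis using stable_retract_iff[OF X] uu vv by blast
qed

text \<open>The section splits \<open>P\<close> off \<open>G\<close>: \<open>s \<cdot> g\<close>
  factors through \<open>P\<close>, and the complementary map \<open>1 - s \<cdot> g\<close> is
  killed by \<open>g\<close>, so it factors through the kernel \<open>K\<close>.\<close>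

lemma stable_retract_split:
  assumes ker: "kernel_of E g k" and k: "k \<in> Hom E K G" and g: "g \<in> Hom E G P"
    and P: "projective E P" and s: "s \<in> Hom E P G" and gs: "g \<cdot> s = Id E P"
  shows "stable_retract E G K"
proof -
  have G: "G \<in> Obj E" and PO: "P \<in> Obj E" using Hom_objs[OF g] by auto
  have sg: "s \<cdot> g \<in> Hom E G G" by (rule Comp_closed[OF g s])
  obtain h where h: "h \<in> Hom E G G" "Add E (s \<cdot> g) h = Id E G"
    using ex_diff[OF Id_closed[OF G] sg] by blast
  have "g = Add E (g \<cdot> (s \<cdot> g)) (g \<cdot> h)"
    using Comp_Add[OF sg h(1) g] h(2) Comp_Id[OF g] by simp
  also have "g \<cdot> (s \<cdot> g) = g" using Comp_assoc[OF g s g] gs Id_Comp[OF g] by simp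
  finally have "g \<cdot> h = Zero E G P"
    using Add_eq_self[OF g Comp_closed[OF h(1) g]] by simp
  then obtain r where r: "r \<in> Hom E G K" "k \<cdot> r = h"
    using kernel_lift[OF ker k g h(1)] by blast
  show ?thesis
    using stable_retract_iff[OF G] r k proj_factoringI[OF P g s] h(2) by metis
qed

text \<open>Functoriality of syzygies on the stable category, in the case of retracts; for \<open>X = Y\<close> it is
  Schanuel's lemma. A lift of \<open>1\<close> through \<open>Y\<close> and a projective to \<open>P \<rightarrow> P\<close> differs from \<open>1\<close>
  by a map that factors as \<open>P \<rightarrow> K \<rightarrow> P\<close>.\<close>

lemma stable_retract_kernels:
  assumes XY: "stable_retract E X Y"
    and c: "(i, p) \<in> Confl E" and i: "i \<in> Hom E K P" and p: "p \<in> Hom E P X" and P: "projective E P"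
    and c': "(i', p') \<in> Confl E" and i': "i' \<in> Hom E K' P'" and p': "p' \<in> Hom E P' Y"
    and P': "projective E P'"
  shows "stable_retract E K K'"
proof -
  have X: "X \<in> Obj E" and K: "K \<in> Obj E" and PO: "P \<in> Obj E" and Y: "Y \<in> Obj E"
    using Hom_objs[OF p] Hom_objs[OF p'] Hom_objs[OF i] by auto
  have d: "deflation E p" and d': "deflation E p'" using c c' by (auto simp: deflation_def)
  note ker = ConflD(1)[OF c i p] and ker' = ConflD(1)[OF c' i' p']
  obtain u v h where u: "u \<in> Hom E X Y" and v: "v \<in> Hom E Y X" and h: "h \<in> proj_factoring E X X"
    and one: "Id E X = Add E h (v \<cdot> u)"
    using XY stable_retract_iff[OF X] by blast
  obtain a b Q where Q: "projective E Q" and a: "a \<in> Hom E X Q" and b: "b \<in> Hom E Q X" and hba: "h = b \<cdot> a"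
    using h by (auto simp: proj_factoring_def)
  \<comment> \<open>The maps \<open>u\<close>, \<open>v\<close> and \<open>b\<close> are lifted
    along the deflations \<open>p\<close> and \<open>p'\<close>; the first two lifts then restrict
    to maps \<open>u2\<close>, \<open>v2\<close> between the kernels.\<close>
  obtain u1 where u1: "u1 \<in> Hom E P P'" "p' \<cdot> u1 = u \<cdot> p"
    using projective_lift[OF P d' p' Comp_closed[OF p u]] by blast
  obtain v1 where v1: "v1 \<in> Hom E P' P" "p \<cdot> v1 = v \<cdot> p'"
    using projective_lift[OF P' d p Comp_closed[OF p' v]] by blast
  obtain b1 where b1: "b1 \<in> Hom E Q P" "p \<cdot> b1 = b"
    using projective_lift[OF Q d p b] by blast
  have u1i: "u1 \<cdot> i \<in> Hom E K P'" and v1i: "v1 \<cdot> i' \<in> Hom E K' P"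
    using Comp_closed[OF i u1(1)] Comp_closed[OF i' v1(1)] by auto
  have "p' \<cdot> (u1 \<cdot> i) = Zero E K Y"
    using Comp_assoc[OF i u1(1) p'] u1(2) Comp_assoc[OF i p u] kernel_Comp[OF ker i p]
      Comp_Zero[OF u K] by simp
  then obtain u2 where u2: "u2 \<in> Hom E K K'" "i' \<cdot> u2 = u1 \<cdot> i"
    using kernel_lift[OF ker' i' p' u1i] by blast
  have "p \<cdot> (v1 \<cdot> i') = Zero E K' X"
    using Comp_assoc[OF i' v1(1) p] v1(2) Comp_assoc[OF i' p' v] kernel_Comp[OF ker' i' p']
      Comp_Zero[OF v] Hom_objs[OF i'] by simp
  then obtain v2 where v2: "v2 \<in> Hom E K' K" "i \<cdot> v2 = v1 \<cdot> i'"
    using kernel_lift[OF ker i p v1i] by blast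
  have ap: "a \<cdot> p \<in> Hom E P Q" by (rule Comp_closed[OF p a])
  have vu1: "v1 \<cdot> u1 \<in> Hom E P P" and bap: "b1 \<cdot> (a \<cdot> p) \<in> Hom E P P"
    using Comp_closed u1(1) v1(1) b1(1) ap by blast+
  \<comment> \<open>\<open>w\<close> lifts \<open>h + vu = 1\<close>, so
    \<open>p \<cdot> w = p\<close>, and the remainder \<open>r = 1 - w\<close> factors as
    \<open>i \<cdot> s\<close>.\<close>
  define w where "w = Add E (b1 \<cdot> (a \<cdot> p)) (v1 \<cdot> u1)"
  have w: "w \<in> Hom E P P" unfolding w_def by (rule Add_closed[OF bap vu1])
  have "p \<cdot> (v1 \<cdot> u1) = v \<cdot> u \<cdot> p"
    using Comp_assoc[OF u1(1) v1(1) p] Comp_assoc[OF u1(1) p' v] Comp_assoc[OF p u v] u1(2) v1(2) by simp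
  moreover have "p \<cdot> (b1 \<cdot> (a \<cdot> p)) = h \<cdot> p"
    using Comp_assoc[OF ap b1(1) p] b1(2) Comp_assoc[OF p a b] hba by simp
  ultimately have pw: "p \<cdot> w = p"
    unfolding w_def
    using Comp_Add[OF bap vu1 p] Add_Comp[OF p proj_factoring_Hom[OF h] Comp_closed[OF u v]] one Id_Comp[OF p]
    by simp
  obtain r where r: "r \<in> Hom E P P" "Add E w r = Id E P"
    using ex_diff[OF Id_closed[OF PO] w] by blast
  have "Add E p (p \<cdot> r) = p"
    using Comp_Add[OF w r(1) p] r(2) pw Comp_Id[OF p] by simp
  then have "p \<cdot> r = Zero E P X" by (rule Add_eq_self[OF p Comp_closed[OF r(1) p]])
  then obtain s where s: "s \<in> Hom E P K" "i \<cdot> s = r"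
    using kernel_lift[OF ker i p r(1)] by blast
  have "(b1 \<cdot> (a \<cdot> p)) \<cdot> i = Zero E K P"
    using Comp_assoc[OF i ap b1(1)] Comp_assoc[OF i p a] kernel_Comp[OF ker i p]
      Comp_Zero[OF a K] Comp_Zero[OF b1(1) K] by simp
  moreover have "v1 \<cdot> u1 \<cdot> i = i \<cdot> (v2 \<cdot> u2)"
    using Comp_assoc[OF i u1(1) v1(1)] u2(2) Comp_assoc[OF u2(1) i' v1(1)] v2(2)
      Comp_assoc[OF u2(1) v2(1) i] by simp
  moreover have vu2: "v2 \<cdot> u2 \<in> Hom E K K" by (rule Comp_closed[OF u2(1) v2(1)])
  ultimately have wi: "w \<cdot> i = i \<cdot> (v2 \<cdot> u2)"
    unfolding w_def using Add_Comp[OF i bap vu1] Zero_Add[OF Comp_closed[OF vu2 i]] by simp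
  have si: "s \<cdot> i \<in> Hom E K K" by (rule Comp_closed[OF i s(1)])
  \<comment> \<open>On \<open>K\<close> the summand through \<open>Q\<close> vanishes because
    \<open>p \<cdot> i = 0\<close>. Cancelling the monomorphism \<open>i\<close> leaves
    \<open>1 = si + v2u2\<close>, with \<open>si\<close> factoring through \<open>P\<close>.\<close>
  have "i \<cdot> Id E K = Add E (i \<cdot> (v2 \<cdot> u2)) (i \<cdot> (s \<cdot> i))"
    using Add_Comp[OF i w r(1)] r(2) wi s(2) Comp_assoc[OF i s(1) i] Id_Comp[OF i] Comp_Id[OF i] by simp
  also have "\<dots> = i \<cdot> Add E (s \<cdot> i) (v2 \<cdot> u2)"
    using Comp_Add[OF vu2 si i] Add_comm[OF si vu2] by simp
  finally have "Id E K = Add E (s \<cdot> i) (v2 \<cdot> u2)"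
    by (rule kernel_mono[OF ker i p Id_closed[OF K] Add_closed[OF si vu2]])
  then show ?thesis
    using stable_retract_iff[OF K] u2(1) v2(1) proj_factoringI[OF P i s(1)] by blast
qed

text \<open>In the pullback \<open>G\<close> of \<open>p\<close> and \<open>p'\<close>, one
  projection has kernel \<open>K'\<close>, the other has kernel \<open>K\<close> and lands in
  \<open>P\<close>. The latter splits because \<open>p'\<close> lifts through the deflation
  \<open>p\<close>.\<close>

lemma pullback_projective:
  assumes c: "(k, p) \<in> Confl E" and k: "k \<in> Hom E K L" and p: "p \<in> Hom E L A"
    and c': "(k', p') \<in> Confl E" and k': "k' \<in> Hom E K' P" and p': "p' \<in> Hom E P A"
    and P: "projective E P"
  shows "\<exists>G j q. j \<in> Hom E K' G \<and> q \<in> Hom E G L \<and> (j, q) \<in> Confl E \<and> stable_retract E G K"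
proof -
  obtain G q g j where q: "q \<in> Hom E G L" and g: "g \<in> Hom E G P" and j: "j \<in> Hom E K' G"
    and pb: "pullback_square E q g p' p" and c'': "(j, q) \<in> Confl E"
    using Confl_pullback[OF c' k' p' p] by blast
  \<comment> \<open>Reading the square in its transposed form identifies the kernel of
    \<open>g\<close> with that of \<open>p\<close>.\<close>
  obtain m where m: "m \<in> Hom E K G" "kernel_of E g m"
    using pullback_kernel[OF pullback_square_sym[OF pb] g q p p' ConflD(1)[OF c k p] k] by blast
  obtain s where s: "s \<in> Hom E P L" "p \<cdot> s = p'"
    using projective_lift[OF P _ p p'] c by (auto simp: deflation_def)
  \<comment> \<open>The lift \<open>s\<close> and the identity of \<open>P\<close> are compatible
    over \<open>A\<close>, so they induce a section of \<open>g\<close>.\<close>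
  obtain t where t: "t \<in> Hom E P G" "g \<cdot> t = Id E P"
    using pullback_lift[OF pb q g s(1) Id_closed] Hom_objs[OF s(1)] s(2) Comp_Id[OF p'] by auto
  have "stable_retract E G K"
    by (rule stable_retract_split[OF m(2,1) g P t])
  then show ?thesis using j q c'' by blast
qed

end

section \<open>Delooping levels\<close>

text \<open>A finite bound excludes the empty set, whose infimum is \<infinity>, and a nonempty set
  of naturals attains its infimum.\<close>

lemma Inf_enat_image_le_iff: "Inf (enat ` A) \<le> enat N \<longleftrightarrow> (\<exists>n \<in> A. n \<le> N)"
proof
  assume le: "Inf (enat ` A) \<le> enat N"
  have "A \<noteq> {}"
  proof
    assume "A = {}"
    then show False using le by (simp add: top_enat_def)
  qed
  then obtain a where "a \<in> A" by blast
  then have "Inf (enat ` A) \<in> enat ` A" by (intro wellorder_InfI[of "enat a"]) simp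
  then obtain b where "b \<in> A" "Inf (enat ` A) = enat b" by blast
  then show "\<exists>n \<in> A. n \<le> N" using le by (intro bexI[of _ b]) simp_all
next
  assume "\<exists>n \<in> A. n \<le> N"
  then obtain n where "n \<in> A" "n \<le> N" by blast
  then show "Inf (enat ` A) \<le> enat N"
    by (intro order_trans[OF Inf_lower[of "enat n"]]) simp_all
qed

lemma dell_le_iff:
  "dell E S k X \<le> enat N \<longleftrightarrow>
    (\<exists>n\<le>N. \<exists>Y \<in> Obj E. stable_retract E ((syzygy E S ^^ n) X) ((syzygy E S ^^ (n + k)) Y))"
  unfolding dell_def Inf_enat_image_le_iff by auto

lemma ddell_le_iff:
  "ddell E S k X \<le> enat N \<longleftrightarrow>
    (\<exists>m\<le>N. \<exists>t\<le>m. \<exists>C d. admissibly_exact E X t C d \<and> (\<forall>i\<le>t. dell E S (i + k) (C i) \<le> enat (m - i)))"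
  unfolding ddell_def Inf_enat_image_le_iff by auto

text \<open>It suffices to exhibit the conflations: they are chosen simultaneously, and the
  differentials are then forced by splicing.\<close>

lemma admissibly_exactI:
  assumes "0 < t" "Z 0 = X" "Z t = C t"
    and "\<And>i. i < t \<Longrightarrow> \<exists>j \<in> Hom E (Z (Suc i)) (C i). \<exists>p \<in> Hom E (C i) (Z i). (j, p) \<in> Confl E"
  shows "\<exists>d. admissibly_exact E X t C d"
proof -
  have "\<forall>i. \<exists>jp. i < t \<longrightarrow>
      fst jp \<in> Hom E (Z (Suc i)) (C i) \<and> snd jp \<in> Hom E (C i) (Z i) \<and> (fst jp, snd jp) \<in> Confl E"
    using assms(4) by fastforce
  from choice[OF this] obtain jp where
    jp: "\<forall>i. i < t \<longrightarrow> fst (jp i) \<in> Hom E (Z (Suc i)) (C i) \<and> snd (jp i) \<in> Hom E (C i) (Z i) \<and>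
      (fst (jp i), snd (jp i)) \<in> Confl E"
    by blast
  define j p where "j i = fst (jp i)" and "p i = snd (jp i)" for i
  have jp: "\<forall>i<t. j i \<in> Hom E (Z (Suc i)) (C i) \<and> p i \<in> Hom E (C i) (Z i) \<and> (j i, p i) \<in> Confl E"
    using jp by (simp add: j_def p_def)
  \<comment> \<open>At \<open>i = t\<close> the last kernel is \<open>C t\<close> itself, so the
    differential is the bare inflation \<open>j (t - 1)\<close>.\<close>
  define d where "d i = (if i = 0 then p 0 else if i = t then j (t - 1) else j (i - 1) \<cdot>\<^bsub>E\<^esub> p i)" for i
  have d: "d 0 = p 0 \<and> (\<forall>i. 0 < i \<and> i < t \<longrightarrow> d i = j (i - 1) \<cdot>\<^bsub>E\<^esub> p i) \<and> d t = j (t - 1)"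
    using assms(1) by (auto simp: d_def)
  have "\<exists>Z j p. Z 0 = X \<and> Z t = C t \<and>
    (\<forall>i<t. j i \<in> Hom E (Z (Suc i)) (C i) \<and> p i \<in> Hom E (C i) (Z i) \<and> (j i, p i) \<in> Confl E) \<and>
    d 0 = p 0 \<and> (\<forall>i. 0 < i \<and> i < t \<longrightarrow> d i = j (i - 1) \<cdot>\<^bsub>E\<^esub> p i) \<and> d t = j (t - 1)"
    by (rule exI[of _ Z], rule exI[of _ j], rule exI[of _ p]) (rule conjI assms(2,3) jp d)+
  then have "admissibly_exact E X t C d"
    using assms(1) by (simp add: admissibly_exact_def)
  then show ?thesis by blast
qed

context exact_category
begin

text \<open>The isomorphism \<open>a\<close> unifies the two cases of the definition: it is
  \<open>d 0\<close> for \<open>t = 0\<close> and an identity for \<open>t > 0\<close>.\<close>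

lemma admissibly_exactD:
  assumes "admissibly_exact E X t C d" and X: "X \<in> Obj E"
  obtains Z a where "Z 0 = X" "a \<in> Hom E (C t) (Z t)" "iso_arr E a"
    "\<forall>i<t. \<exists>j \<in> Hom E (Z (Suc i)) (C i). \<exists>p \<in> Hom E (C i) (Z i). (j, p) \<in> Confl E"
proof (cases "t = 0")
  case True
  then show ?thesis using assms(1) that[of "\<lambda>_. X" "d 0"] by (simp add: admissibly_exact_def)
next
  case False
  then obtain Z j p where Z: "Z 0 = X" "Z t = C t"
    and jp: "\<forall>i<t. j i \<in> Hom E (Z (Suc i)) (C i) \<and> p i \<in> Hom E (C i) (Z i) \<and> (j i, p i) \<in> Confl E"
    using assms(1) unfolding admissibly_exact_def if_not_P[OF False] by blast
  have "Z (Suc (t - 1)) \<in> Obj E" using jp[rule_format, of "t - 1"] False Hom_objs by auto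
  then have Ct: "C t \<in> Obj E" using False Z(2) by simp
  show ?thesis
  proof (rule that[of Z "Id E (C t)"])
    show "Id E (C t) \<in> Hom E (C t) (Z t)" using Id_closed[OF Ct] Z(2) by simp
  qed (use Z(1) jp iso_arr_Id[OF category_E Ct] in blast)+
qed

lemma Confl_iso_right:
  assumes c: "(k, p) \<in> Confl E" and k: "k \<in> Hom E K P" and p: "p \<in> Hom E P X"
    and a: "a \<in> Hom E X Y" "iso_arr E a"
  shows "(k, a \<cdot> p) \<in> Confl E"
proof -
  have eq: "Dom E k = K" "Cod E k = P" "Cod E p = X" using k p by (auto simp: Hom_def)
  have o: "K \<in> Obj E" "P \<in> Obj E" using Hom_objs[OF k] by auto
  show ?thesis
    by (rule Confl_iso[OF c k Comp_closed[OF p a(1)] _ _ _ iso_arr_Id[OF category_E o(1)]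
          iso_arr_Id[OF category_E o(2)] a(2)])
      (use eq Id_closed o a(1) Id_Comp[OF k] Comp_Id[OF k] Comp_Id[OF Comp_closed[OF p a(1)]] in auto)
qed

end

section \<open>Syzygies of objects and of admissibly exact sequences\<close>

locale exact_category_syzygies = exact_category E
  for E :: "('o, 'm, 'x) exact_cat_scheme" (structure) +
  fixes S :: "'o \<Rightarrow> 'm \<times> 'm"
  assumes syzygy_choice: "syzygy_choice E S"
begin

abbreviation \<Omega> :: "'o \<Rightarrow> 'o" where
  "\<Omega> \<equiv> syzygy E S"

lemma syzygy_Confl:
  assumes "X \<in> Obj E"
  obtains P k p where "projective E P" "k \<in> Hom E (\<Omega> X) P" "p \<in> Hom E P X" "(k, p) \<in> Confl E"
proof -
  have S: "(fst (S X), snd (S X)) \<in> Confl E" "Cod E (snd (S X)) = X" "projective E (Dom E (snd (S X)))"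
    using syzygy_choice assms by (auto simp: syzygy_choice_def)
  show ?thesis
    using that[OF S(3)] Confl_Hom[OF S(1)] S(1,2) by (simp add: syzygy_def)
qed

lemma syzygy_Obj: "X \<in> Obj E \<Longrightarrow> \<Omega> X \<in> Obj E"
  using syzygy_Confl[of X] Hom_objs(1) by metis

lemma syzygy_funpow_Obj: "X \<in> Obj E \<Longrightarrow> (\<Omega> ^^ n) X \<in> Obj E"
  by (induction n) (simp_all add: syzygy_Obj)

lemma stable_retract_syzygy:
  assumes "stable_retract E X Y" "X \<in> Obj E" "Y \<in> Obj E"
  shows "stable_retract E (\<Omega> X) (\<Omega> Y)"
proof -
  obtain P k p where 1: "projective E P" "k \<in> Hom E (\<Omega> X) P" "p \<in> Hom E P X" "(k, p) \<in> Confl E"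
    using syzygy_Confl[OF assms(2)] .
  obtain P' k' p' where 2: "projective E P'" "k' \<in> Hom E (\<Omega> Y) P'" "p' \<in> Hom E P' Y" "(k', p') \<in> Confl E"
    using syzygy_Confl[OF assms(3)] .
  show ?thesis by (rule stable_retract_kernels[OF assms(1) 1(4,2,3,1) 2(4,2,3,1)])
qed

lemma stable_retract_syzygy_funpow:
  "stable_retract E X Y \<Longrightarrow> X \<in> Obj E \<Longrightarrow> Y \<in> Obj E \<Longrightarrow> stable_retract E ((\<Omega> ^^ n) X) ((\<Omega> ^^ n) Y)"
  by (induction n) (simp_all add: stable_retract_syzygy syzygy_funpow_Obj)

text \<open>The same \<open>n\<close> and \<open>Y\<close> work: applying \<open>\<Omega>\<close> to
  the retraction for \<open>X\<close> adds one syzygy on both sides, and \<open>\<Omega>\<close>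
  commutes with its own iterates.\<close>

lemma dell_syzygy_retract:
  assumes "dell E S k X \<le> enat N" and X: "X \<in> Obj E" and G: "G \<in> Obj E" and r: "stable_retract E G (\<Omega> X)"
  shows "dell E S (Suc k) G \<le> enat N"
proof -
  obtain n Y where n: "n \<le> N" and Y: "Y \<in> Obj E" and XY: "stable_retract E ((\<Omega> ^^ n) X) ((\<Omega> ^^ (n + k)) Y)"
    using assms(1) unfolding dell_le_iff by blast
  have "stable_retract E ((\<Omega> ^^ n) G) ((\<Omega> ^^ n) (\<Omega> X))"
    by (rule stable_retract_syzygy_funpow[OF r G syzygy_Obj[OF X]])
  moreover have "stable_retract E (\<Omega> ((\<Omega> ^^ n) X)) (\<Omega> ((\<Omega> ^^ (n + k)) Y))"
    by (rule stable_retract_syzygy[OF XY syzygy_funpow_Obj[OF X] syzygy_funpow_Obj[OF Y]])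
  ultimately have "stable_retract E ((\<Omega> ^^ n) G) ((\<Omega> ^^ (n + Suc k)) Y)"
    using stable_retract_trans[OF syzygy_funpow_Obj[OF G], of n "\<Omega> ((\<Omega> ^^ n) X)"]
    by (simp add: funpow_swap1)
  then show ?thesis unfolding dell_le_iff using n Y by blast
qed

lemma admissibly_exact_syzygies:
  assumes ex: "admissibly_exact E Y t C d" and Y: "Y \<in> Obj E"
  obtains Z L where "Z 0 = Y" "L t = \<Omega> (C t)" "\<forall>i\<le>t. C i \<in> Obj E"
    "\<forall>i\<le>t. \<exists>P l s. projective E P \<and> l \<in> Hom E (L i) P \<and> s \<in> Hom E P (Z i) \<and> (l, s) \<in> Confl E"
    "\<forall>i<t. \<exists>k q. k \<in> Hom E (\<Omega> (C i)) (L i) \<and> q \<in> Hom E (L i) (Z (Suc i)) \<and> (k, q) \<in> Confl E"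
proof -
  obtain Z a where Z: "Z 0 = Y" and a: "a \<in> Hom E (C t) (Z t)" "iso_arr E a"
    and cf: "\<forall>i<t. \<exists>j \<in> Hom E (Z (Suc i)) (C i). \<exists>p \<in> Hom E (C i) (Z i). (j, p) \<in> Confl E"
    using admissibly_exactD[OF ex Y] .
  have C: "C i \<in> Obj E" if "i \<le> t" for i
    using that cf[rule_format, of i] Hom_objs a(1) by (cases "i = t") auto
  \<comment> \<open>\<open>H\<close> says that \<open>M\<close> is a syzygy of \<open>Z i\<close>,
    and \<open>K\<close> that it is an extension of \<open>Z (Suc i)\<close> by the syzygy of
    \<open>C i\<close>; naming them allows all \<open>L i\<close> to be chosen at once.\<close>
  define H where "H i M \<longleftrightarrow>
    (\<exists>P l s. projective E P \<and> l \<in> Hom E M P \<and> s \<in> Hom E P (Z i) \<and> (l, s) \<in> Confl E)" for i M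
  define K where "K i M \<longleftrightarrow>
    (\<exists>k q. k \<in> Hom E (\<Omega> (C i)) M \<and> q \<in> Hom E M (Z (Suc i)) \<and> (k, q) \<in> Confl E)" for i M
  have "\<exists>M. (i = t \<longrightarrow> M = \<Omega> (C t)) \<and> H i M \<and> (i < t \<longrightarrow> K i M)"
    if i: "i \<le> t" for i
  proof -
    obtain P k p where P: "projective E P" and k: "k \<in> Hom E (\<Omega> (C i)) P" and p: "p \<in> Hom E P (C i)"
      and kp: "(k, p) \<in> Confl E"
      using syzygy_Confl[OF C[OF i]] .
    show ?thesis
    proof (cases "i = t")
      case True
      \<comment> \<open>At the end of the sequence, composing with \<open>a\<close> changes only the
        target, so the chosen syzygy of \<open>C t\<close> also serves for
        \<open>Z t\<close>.\<close>
      have "(k, a \<cdot> p) \<in> Confl E" "a \<cdot> p \<in> Hom E P (Z i)"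
        using Confl_iso_right[OF kp k p, of a "Z t"] Comp_closed[OF p, of a "Z t"] a True by auto
      then show ?thesis using P k True unfolding H_def by blast
    next
      case False
      then have "i < t" using i by simp
      then obtain j q where j: "j \<in> Hom E (Z (Suc i)) (C i)" and q: "q \<in> Hom E (C i) (Z i)" and jq: "(j, q) \<in> Confl E"
        using cf by blast
      obtain M l k' p' where "l \<in> Hom E M P" "(l, q \<cdot> p) \<in> Confl E"
        "k' \<in> Hom E (\<Omega> (C i)) M" "p' \<in> Hom E M (Z (Suc i))" "(k', p') \<in> Confl E"
        using rotation[OF jq j q kp k p] by blast
      then have "H i M" "K i M"
        unfolding H_def K_def using P Comp_closed[OF p q] by blast+
      then show ?thesis using False by blast
    qed
  qed
  then have "\<forall>i. \<exists>M. i \<le> t \<longrightarrow> (i = t \<longrightarrow> M = \<Omega> (C t)) \<and> H i M \<and> (i < t \<longrightarrow> K i M)"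
    by blast
  from choice[OF this] obtain L where
    L: "\<forall>i. i \<le> t \<longrightarrow> (i = t \<longrightarrow> L i = \<Omega> (C t)) \<and> H i (L i) \<and> (i < t \<longrightarrow> K i (L i))" ..
  show ?thesis
  proof (rule that[of Z L])
    show "\<forall>i\<le>t. \<exists>P l s. projective E P \<and> l \<in> Hom E (L i) P \<and> s \<in> Hom E P (Z i) \<and> (l, s) \<in> Confl E"
      using L unfolding H_def[symmetric] by simp
    show "\<forall>i<t. \<exists>k q. k \<in> Hom E (\<Omega> (C i)) (L i) \<and> q \<in> Hom E (L i) (Z (Suc i)) \<and> (k, q) \<in> Confl E"
      using L unfolding K_def[symmetric] by simp
  qed (use Z L[rule_format, of t] C in simp_all)
qed

section \<open>The sequence for the subobject and its delooping levels\<close>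

lemma ddell_inflation:
  assumes f: "f \<in> Hom E X Y" and infl: "inflation E f" and le: "ddell E S 1 Y \<le> enat N"
  shows "ddell E S 1 X \<le> enat (Suc N)"
proof -
  have Y: "Y \<in> Obj E" using Hom_objs[OF f] by simp
  obtain m t C d where m: "m \<le> N" and t: "t \<le> m" and ex: "admissibly_exact E Y t C d"
    and dell: "\<And>i. i \<le> t \<Longrightarrow> dell E S (i + 1) (C i) \<le> enat (m - i)"
    using le unfolding ddell_le_iff by blast
  obtain Z L where Z: "Z 0 = Y" and Lt: "L t = \<Omega> (C t)" and C: "\<forall>i\<le>t. C i \<in> Obj E"
    and LP: "\<forall>i\<le>t. \<exists>P l s. projective E P \<and> l \<in> Hom E (L i) P \<and> s \<in> Hom E P (Z i) \<and> (l, s) \<in> Confl E"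
    and CL: "\<forall>i<t. \<exists>k q. k \<in> Hom E (\<Omega> (C i)) (L i) \<and> q \<in> Hom E (L i) (Z (Suc i)) \<and> (k, q) \<in> Confl E"
    using admissibly_exact_syzygies[OF ex Y] .
  define H where "H i M \<longleftrightarrow>
    (\<exists>j \<in> Hom E (L (Suc i)) M. \<exists>q \<in> Hom E M (L i). (j, q) \<in> Confl E)" for i M
  have "\<exists>M. H i M \<and> stable_retract E M (\<Omega> (C i))"
    if i: "i < t" for i
  proof -
    obtain k q where kq: "(k, q) \<in> Confl E" "k \<in> Hom E (\<Omega> (C i)) (L i)" "q \<in> Hom E (L i) (Z (Suc i))"
      using CL[rule_format, OF i] by blast
    obtain P l s where ls: "(l, s) \<in> Confl E" "l \<in> Hom E (L (Suc i)) P" "s \<in> Hom E P (Z (Suc i))" "projective E P"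
      using LP[rule_format, of "Suc i"] i by auto
    \<comment> \<open>\<open>L i\<close> and a projective both map by deflations onto
      \<open>Z (Suc i)\<close>; their pullback is the required \<open>M\<close>.\<close>
    show ?thesis unfolding H_def using pullback_projective[OF kq ls] by blast
  qed
  then have "\<forall>i. \<exists>M. i < t \<longrightarrow> H i M \<and> stable_retract E M (\<Omega> (C i))"
    by blast
  from choice[OF this] obtain G where
    HG: "\<forall>i. i < t \<longrightarrow> H i (G i) \<and> stable_retract E (G i) (\<Omega> (C i))" ..
  have G: "\<exists>j \<in> Hom E (L (Suc i)) (G i). \<exists>q \<in> Hom E (G i) (L i). (j, q) \<in> Confl E"
    and GC: "stable_retract E (G i) (\<Omega> (C i))" if "i < t" for i
    using HG that by (simp_all add: H_def)
  obtain g where fg: "(f, g) \<in> Confl E" using infl by (auto simp: inflation_def)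
  obtain W where g: "g \<in> Hom E Y W"
    using ConflD(2)[OF fg f Confl_Hom(2)[OF fg]] Confl_Hom(2)[OF fg] by auto
  have W: "W \<in> Obj E" using Hom_objs[OF g] by simp
  obtain P l s where P: "projective E P" and l: "l \<in> Hom E (L 0) P" and s: "s \<in> Hom E P Y" and ls: "(l, s) \<in> Confl E"
    using LP[rule_format, of 0] Z by auto
  \<comment> \<open>Rotating \<open>X \<rightarrow> Y \<rightarrow> W\<close> along the projective
    deflation onto \<open>Y\<close> resolves \<open>X\<close> by \<open>D0\<close>, which is itself
    a syzygy of \<open>W\<close>.\<close>
  obtain D0 e k p where e: "e \<in> Hom E D0 P" "(e, g \<cdot> s) \<in> Confl E"
    and k: "k \<in> Hom E (L 0) D0" and p: "p \<in> Hom E D0 X" and kp: "(k, p) \<in> Confl E"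
    using rotation[OF fg f g ls l s] by blast
  obtain P' k' p' where W': "projective E P'" "k' \<in> Hom E (\<Omega> W) P'" "p' \<in> Hom E P' W" "(k', p') \<in> Confl E"
    using syzygy_Confl[OF W] .
  have D0: "stable_retract E D0 (\<Omega> W)"
    by (rule stable_retract_kernels[OF stable_retract_refl[OF W] e(2,1) Comp_closed[OF s g] P W'(4,2,3,1)])
  \<comment> \<open>Everything moves up by one index to make room for \<open>D0\<close>; the final
    term \<open>D (Suc t)\<close> is \<open>L t\<close>, the last kernel in
    \<open>Z'\<close>.\<close>
  define D where "D i = (case i of 0 \<Rightarrow> D0 | Suc i \<Rightarrow> if i < t then G i else L t)" for i
  define Z' where "Z' i = (case i of 0 \<Rightarrow> X | Suc i \<Rightarrow> L i)" for i
  have "\<exists>j \<in> Hom E (Z' (Suc i)) (D i). \<exists>p \<in> Hom E (D i) (Z' i). (j, p) \<in> Confl E" if "i < Suc t" for i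
    using that G k p kp by (cases i) (auto simp: D_def Z'_def)
  then obtain d' where d': "admissibly_exact E X (Suc t) D d'"
    using admissibly_exactI[of "Suc t" Z' X D E] by (auto simp: D_def Z'_def)
  have "dell E S (i + 1) (D i) \<le> enat (Suc m - i)" if i: "i \<le> Suc t" for i
  proof (cases i)
    case 0
    \<comment> \<open>\<open>W\<close> is the witness: \<open>D0\<close> is already a stable retract
      of a first syzygy.\<close>
    have "dell E S 1 D0 \<le> enat 0" unfolding dell_le_iff using D0 W by auto
    then show ?thesis using 0 order_trans[of _ "enat 0" "enat (Suc m)"] by (simp add: D_def)
  next
    case (Suc n)
    then have n: "n \<le> t" using i by simp
    \<comment> \<open>The index shift matches the bounds: passing to a syzygy raises
      \<open>n + 1\<close> to \<open>n + 2\<close>, while \<open>Suc m - Suc n = m - n\<close>. For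
      \<open>n = t\<close> the term is the syzygy of \<open>C t\<close> itself.\<close>
    have "D i \<in> Obj E \<and> stable_retract E (D i) (\<Omega> (C n))"
    proof (cases "n < t")
      case True
      then show ?thesis using G[OF True] GC[OF True] Hom_objs by (auto simp: D_def Suc)
    next
      case False
      then show ?thesis
        using n Lt syzygy_Obj[OF C[rule_format, OF n]] stable_retract_refl[OF syzygy_Obj[OF C[rule_format, OF n]]]
        by (simp add: D_def Suc)
    qed
    then show ?thesis using dell_syzygy_retract[OF dell[OF n] C[rule_format, OF n]] Suc by simp
  qed
  then have "\<forall>i\<le>Suc t. dell E S (i + 1) (D i) \<le> enat (Suc m - i)" by blast
  then show ?thesis
    unfolding ddell_le_iff using d' t m
    by (intro exI[of _ "Suc m"] exI[of _ "Suc t"] exI[of _ D] exI[of _ d'] conjI) simp_all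
qed

end

theorem corollary3p6:
  fixes E :: "('o, 'm) exact_cat" and S :: "'o \<Rightarrow> 'm \<times> 'm" and X Y :: 'o and f :: 'm
  assumes "exact_category E"
    and "idempotent_complete E"
    and "enough_projectives E"
    and "syzygy_choice E S"
    and "f \<in> Hom E X Y"
    and "inflation E f"
  shows "ddell E S 1 X \<le> ddell E S 1 Y + 1"
proof (cases "ddell E S 1 Y")
  \<comment> \<open>Only a finite level of \<open>Y\<close> needs an argument; for \<infinity> the
    right-hand side is \<infinity>.\<close>
  case (enat N)
  interpret exact_category_syzygies E S
    using assms(1,4) by (simp add: exact_category_syzygies_def exact_category_syzygies_axioms_def)
  have "ddell E S 1 X \<le> enat (Suc N)"
    using ddell_inflation[OF assms(5,6)] enat by simp
  then show ?thesis using enat by (simp add: one_enat_def)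
qed simp

end
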